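(* For $x\in(0,\pi/4]$ let $U=(\cos^3x+i\sin^3x)\sigma_0\otimes\sigma_0+i\sin x\cos x\,e^{-ix}\sum_{j=1}^3\sigma_j\otimes\sigma_j$. Let $x_0\approx0.1018$ be the (positive) root of $$H(\cos^22x_0,\sin^22x_0)=H(\cos^6x_0+\sin^6x_0,\cos^2x_0\sin^2x_0,\cos^2x_0\sin^2x_0,\cos^2x_0\sin^2x_0).$$ (i) If $0<x\le x_0$, then $K_E(U)=H(\cos^22x,\sin^22x)$ ebits, attained by the input state $|00\rangle_{AR_A}\otimes|11\rangle_{BR_B}$. (ii) If $x_0\le x\le\pi/4$, then $K_E(U)=H(\cos^6x+\sin^6x,\cos^2x\sin^2x,\cos^2x\sin^2x,\cos^2x\sin^2x)$ ebits, attained by the input state $\frac{1}{\sqrt2}(|00\rangle+|11\rangle)_{AR_A}\otimes\frac{1}{\sqrt2}(|00\rangle+|11\rangle)_{BR_B}$.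
   Context: Pauli matrices: $\sigma_0=I$, $\sigma_1=\begin{pmatrix}0&1\\1&0\end{pmatrix}$, $\sigma_2=\begin{pmatrix}0&-i\\i&0\end{pmatrix}$, $\sigma_3=\begin{pmatrix}1&0\\0&-1\end{pmatrix}$; $U$ acts on qubits $A,B$. The entangling power is $K_E(U)=\max E\big(U(|\phi\rangle_{AR_A}\otimes|\psi\rangle_{BR_B})\big)$, the maximum over pure states on $AR_A$ and $BR_B$ with arbitrary finite-dimensional ancillas $R_A,R_B$ ($U$ acting on $A,B$), where $E(|\chi\rangle)=S(\mathrm{Tr}_{AR_A}|\chi\rangle\langle\chi|)$ is the von Neumann entropy, base-2 logarithm (ebits). $H(p_1,\dots,p_k)=-\sum_ip_i\log_2p_i$ is the Shannon entropy. *)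

theory Defs
  imports Complex_Main "Jordan_Normal_Form.Char_Poly"
begin

definition eta :: "real \<Rightarrow> real" where
  "eta t = (if t \<le> 0 then 0 else - t * log 2 t)"

definition shannon :: "real list \<Rightarrow> real" where
  "shannon ps = sum_list (map eta ps)"

(* von Neumann entropy (base 2) of a density matrix rho: -sum lambda log2 lambda over the
   eigenvalues of rho counted with (algebraic) multiplicity, i.e. the roots of the
   characteristic polynomial with their orders.  For a density matrix (Hermitian, PSD)
   all eigenvalues are real and nonnegative. *)
definition vn_entropy :: "complex mat \<Rightarrow> real" where
  "vn_entropy rho =
     (\<Sum>l \<in> {l. poly (char_poly rho) l = 0}. real (order l (char_poly rho)) * eta (Re l))"

definition pauli :: "nat \<Rightarrow> complex mat" where
  "pauli j = (if j = 1 then mat_of_rows_list 2 [[0, 1], [1, 0]]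
              else if j = 2 then mat_of_rows_list 2 [[0, -\<i>], [\<i>, 0]]
              else if j = 3 then mat_of_rows_list 2 [[1, 0], [0, -1]]
              else mat_of_rows_list 2 [[1, 0], [0, 1]])"

(* tensor product of two 2x2 matrices acting on A (x) B, basis index 2*a + b *)
definition kron2 :: "complex mat \<Rightarrow> complex mat \<Rightarrow> complex mat" where
  "kron2 M N = mat 4 4 (\<lambda>(i, j). M $$ (i div 2, j div 2) * N $$ (i mod 2, j mod 2))"

definition Ugate :: "real \<Rightarrow> complex mat" where
  "Ugate x =
     (complex_of_real ((cos x)^3) + \<i> * complex_of_real ((sin x)^3)) \<cdot>\<^sub>m kron2 (pauli 0) (pauli 0)
   + (\<i> * complex_of_real (sin x * cos x) * exp (- \<i> * complex_of_real x)) \<cdot>\<^sub>m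
       (kron2 (pauli 1) (pauli 1) + kron2 (pauli 2) (pauli 2) + kron2 (pauli 3) (pauli 3))"

definition unit_state :: "nat \<Rightarrow> complex vec \<Rightarrow> bool" where
  "unit_state d v \<longleftrightarrow> v \<in> carrier_vec d \<and> (\<Sum>i<d. (cmod (v $ i))^2) = 1"

(* Input |phi>_{A R_A} in C^2 (x) C^dRA, basis index a*dRA + r;
   input |psi>_{B R_B} in C^2 (x) C^dRB, basis index b*dRB + s.
   Amplitude of U(|phi> (x) |psi>) at |a r b s>, U acting on A,B (U basis index 2*a + b). *)
definition out_amp ::
  "complex mat \<Rightarrow> nat \<Rightarrow> nat \<Rightarrow> complex vec \<Rightarrow> complex vec \<Rightarrow> nat \<Rightarrow> nat \<Rightarrow> nat \<Rightarrow> nat \<Rightarrow> complex" where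
  "out_amp U dRA dRB phi psi a r b s =
     (\<Sum>a'<2. \<Sum>b'<2. U $$ (2 * a + b, 2 * a' + b') * phi $ (a' * dRA + r) * psi $ (b' * dRB + s))"

(* reduced state Tr_{A R_A} of U(|phi> (x) |psi>), a matrix on B R_B (index b*dRB + s) *)
definition reduced_BR ::
  "complex mat \<Rightarrow> nat \<Rightarrow> nat \<Rightarrow> complex vec \<Rightarrow> complex vec \<Rightarrow> complex mat" where
  "reduced_BR U dRA dRB phi psi =
     mat (2 * dRB) (2 * dRB) (\<lambda>(i, j).
       \<Sum>a<2. \<Sum>r<dRA. out_amp U dRA dRB phi psi a r (i div dRB) (i mod dRB)
                       * cnj (out_amp U dRA dRB phi psi a r (j div dRB) (j mod dRB)))"

definition ent_out :: "complex mat \<Rightarrow> nat \<Rightarrow> nat \<Rightarrow> complex vec \<Rightarrow> complex vec \<Rightarrow> real" where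
  "ent_out U dRA dRB phi psi = vn_entropy (reduced_BR U dRA dRB phi psi)"

definition entangling_power :: "complex mat \<Rightarrow> real" where
  "entangling_power U = Sup {ent_out U dRA dRB phi psi | dRA dRB phi psi.
       dRA \<ge> 1 \<and> dRB \<ge> 1 \<and> unit_state (2 * dRA) phi \<and> unit_state (2 * dRB) psi}"

(* |00>_{A R_A} (dRA = 2) and |11>_{B R_B} (dRB = 2) *)
definition ket00 :: "complex vec" where "ket00 = unit_vec 4 0"
definition ket11 :: "complex vec" where "ket11 = unit_vec 4 3"
(* (|00> + |11>)/sqrt 2 with a 2-dimensional ancilla *)
definition bell :: "complex vec" where
  "bell = vec 4 (\<lambda>i. if i = 0 \<or> i = 3 then complex_of_real (1 / sqrt 2) else 0)"

end

theory Submission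
  imports Defs
begin

text \<open>
  Up to a phase the gate is \<open>cos \<theta> \<cdot> 1 + \<i> sin \<theta> \<cdot> SWAP\<close> with \<open>\<theta> = 2x\<close>, so it commutes with every
  \<open>V \<otimes> V\<close>. Diagonalising the reduced input state of \<open>B\<close> by such a \<open>V\<close> and discarding the coherences
  between the \<open>V\<close>-charge sectors of the output on \<open>B R\<^sub>B\<close> can only increase the entropy (a diagonal has
  larger entropy than the spectrum). With \<open>p\<close>, \<open>q\<close> the populations of \<open>A\<close> and \<open>B\<close> in that basis,
  \<open>u = p (1 - q)\<close>, \<open>v = (1 - p) q\<close> and \<open>4a = sin\<^sup>2 \<theta>\<close>, what remains is the spectrum \<open>4au, 4av, l, m\<close> with
  \<open>l + m = 1 - 4a (u + v)\<close> and \<open>l m = 16a (1 - 3a) u v\<close>.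

  For fixed \<open>u + v\<close> the entropy grows with \<open>u v\<close>. If \<open>u + v \<le> 1/2\<close>, the Gibbs inequality against
  \<open>(a, a, a, 1 - 3a)\<close> bounds it by the value \<open>H\<^sub>2\<close> of the Bell input. Otherwise one is on the path of
  antipodal Bloch vectors of length \<open>\<surd>y\<close>, which joins the Bell input (\<open>y = 0\<close>) to the product input
  (\<open>y = 1\<close>, value \<open>H\<^sub>1\<close>): there the entropy is at most \<open>H\<^sub>2\<close> if \<open>a \<ge> 1/16\<close> and lies below the chord
  \<open>y H\<^sub>1 + (1 - y) H\<^sub>2\<close> if \<open>a \<le> 1/16\<close>. Finally \<open>(H\<^sub>2 - H\<^sub>1) / a\<close> is increasing in \<open>a\<close>, so the two values
  cross exactly once.
\<close>

section \<open>Entropy inequalities\<close>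

text \<open>Natural logarithms keep the derivatives below free of the factor \<open>ln 2\<close>,
  which is divided out only at the end.\<close>

definition nent :: "real \<Rightarrow> real" where
  "nent t = - t * ln t"

lemma eta_eq_nent: "0 \<le> t \<Longrightarrow> eta t = nent t / ln 2"
  by (auto simp: eta_def nent_def log_def)

lemma nent_0 [simp]: "nent 0 = 0"
  by (simp add: nent_def)

text \<open>The right-hand side is the tangent at \<open>z\<close> of a concave function. Summed
  over two probability vectors, the terms \<open>z - t\<close> cancel and the Gibbs inequality
  remains.\<close>

lemma nent_le_tangent:
  assumes "0 \<le> t" "0 < z"
  shows "nent t \<le> - t * ln z + (z - t)"
proof (cases "t = 0")
  case False
  then have "ln (z / t) \<le> z / t - 1"
    using assms by (intro ln_le_minus_one) auto
  then have "t * (ln z - ln t) \<le> t * (z / t - 1)"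
    using assms False by (intro mult_left_mono) (auto simp: ln_div)
  then show ?thesis
    using False by (simp add: nent_def algebra_simps)
qed (use assms in simp)

text \<open>Add up the tangents at the mean: the weighted deviations from the mean cancel. A mean of
  zero has no tangent, but then every weighted term vanishes.\<close>

lemma nent_jensen:
  assumes fin: "finite J" and w: "\<And>j. j \<in> J \<Longrightarrow> 0 \<le> w j" and w1: "sum w J = 1"
    and x: "\<And>j. j \<in> J \<Longrightarrow> 0 \<le> x j"
  shows "(\<Sum>j\<in>J. w j * nent (x j)) \<le> nent (\<Sum>j\<in>J. w j * x j)"
proof -
  define X where "X = (\<Sum>j\<in>J. w j * x j)"
  have X0: "0 \<le> X" unfolding X_def by (intro sum_nonneg mult_nonneg_nonneg w x)
  show ?thesis
  proof (cases "X = 0")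
    case True
    then have "w j * x j = 0" if "j \<in> J" for j
      using sum_nonneg_eq_0_iff[OF fin, of "\<lambda>j. w j * x j"] w x that by (auto simp: X_def)
    then have "(\<Sum>j\<in>J. w j * nent (x j)) = 0"
      by (intro sum.neutral) (auto simp: nent_def)
    then show ?thesis using True by (simp add: X_def)
  next
    case False
    have "(\<Sum>j\<in>J. w j * nent (x j)) \<le> (\<Sum>j\<in>J. w j * (- x j * ln X + (X - x j)))"
      using False X0 by (intro sum_mono mult_left_mono nent_le_tangent w x) auto
    also have "\<dots> = (\<Sum>j\<in>J. - (w j * x j) * (ln X + 1) + w j * X)"
      by (intro sum.cong) (auto simp: algebra_simps)
    also have "\<dots> = - X * (ln X + 1) + sum w J * X"
      unfolding sum.distrib sum_distrib_right[symmetric] sum_negf X_def[symmetric] ..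
    also have "\<dots> = - X * (ln X + 1) + X" by (simp add: w1)
    also have "\<dots> = nent X" by (simp add: nent_def algebra_simps)
    finally show ?thesis by (simp add: X_def)
  qed
qed

text \<open>A larger product at equal sum means that the pair is less spread out:
  \<open>(x', y')\<close> arises from \<open>(x, y)\<close> by averaging, and concavity does the
  rest.\<close>

lemma nent_add_mono_product:
  assumes nn: "0 \<le> x" "0 \<le> y" "0 \<le> x'" "0 \<le> y'" and s: "x + y = x' + y'" and p: "x * y \<le> x' * y'"
  shows "nent x + nent y \<le> nent x' + nent y'"
proof -
  have *: "nent x + nent y \<le> nent x' + nent y'"
    if nn: "0 \<le> x" "0 \<le> y" "0 \<le> x'" "0 \<le> y'" and s: "x + y = x' + y'" and p: "x * y \<le> x' * y'"
      and o: "x \<le> y" for x y x' y' :: real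
  proof (cases "x = y")
    case True
    have "(x' - y')^2 = (x' + y')^2 - 4 * (x' * y')" by (simp add: power2_eq_square algebra_simps)
    also have "\<dots> = 4 * (x * y) - 4 * (x' * y')" using True by (simp flip: s add: power2_eq_square)
    also have "\<dots> \<le> 0" using p by simp
    finally have "(x' - y')^2 = 0" by (simp add: order_antisym)
    then have "x' = y'" by simp
    then show ?thesis using s True by simp
  next
    case False
    with o have o: "x < y" by simp
    \<comment> \<open>Eliminating \<open>y'\<close> from the product inequality leaves a quadratic
      in \<open>x'\<close> that is nonpositive only between \<open>x\<close> and
      \<open>y\<close>.\<close>
    have "(x' - x) * (x' - y) \<le> 0"
    proof -
      have "y' = x + y - x'" using s by simp
      with p show ?thesis by (simp add: algebra_simps)
    qed
    then have b: "x \<le> x'" "x' \<le> y" using o by (auto simp: mult_le_0_iff)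
    define t where "t = (x' - x) / (y - x)"
    have t: "0 \<le> t" "t \<le> 1" using b o by (auto simp: t_def)
    have "t * (y - x) = x' - x" using o by (simp add: t_def)
    then have x': "x' = (1 - t) * x + t * y" by (simp add: algebra_simps)
    have y': "y' = t * x + (1 - t) * y" using s x' by (simp add: algebra_simps)
    have J: "(1 - a) * nent x + a * nent y \<le> nent ((1 - a) * x + a * y)" if "0 \<le> a" "a \<le> 1" for a
      using nent_jensen[of "{False,True}" "\<lambda>b. if b then a else 1 - a" "\<lambda>b. if b then y else x"] that nn
      by simp
    show ?thesis
      using J[of t] J[of "1 - t"] t by (simp add: x' y' algebra_simps)
  qed
  show ?thesis
  proof (cases "x \<le> y")
    case True then show ?thesis using * assms by blast
  next
    case False then show ?thesis using *[of y x x' y'] assms by (simp add: mult.commute add.commute)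
  qed
qed

text \<open>Twice Pinsker's inequality for the coin \<open>(1 + k) / 2\<close>,
  \<open>(1 - k) / 2\<close> against a fair one. The difference of the sides and its derivative
  vanish at 0, and its second derivative is nonnegative.\<close>

lemma binary_pinsker:
  assumes "0 \<le> k" "k < 1"
  shows "k^2 \<le> (1 + k) * ln (1 + k) + (1 - k) * ln (1 - k :: real)"
proof -
  let ?f = "\<lambda>k::real. (1 + k) * ln (1 + k) + (1 - k) * ln (1 - k) - k^2"
  have "?f 0 \<le> ?f k"
  proof (rule DERIV_nonneg_imp_nondecreasing[OF assms(1)], intro exI conjI)
    fix z assume z: "0 \<le> z" "z \<le> k"
    then have z1: "z < 1" using assms by simp
    show "(?f has_real_derivative (ln (1 + z) - ln (1 - z) - 2 * z)) (at z)"
      using z z1 by (auto intro!: derivative_eq_intros)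
    show "0 \<le> ln (1 + z) - ln (1 - z) - 2 * z"
    proof -
      let ?g = "\<lambda>z::real. ln (1 + z) - ln (1 - z) - 2 * z"
      have "?g 0 \<le> ?g z"
      proof (rule DERIV_nonneg_imp_nondecreasing[OF z(1)], intro exI conjI)
        fix w assume w: "0 \<le> w" "w \<le> z"
        then have w1: "w < 1" using z1 by simp
        show "(?g has_real_derivative (1 / (1 + w) + 1 / (1 - w) - 2)) (at w)"
          using w w1 by (auto intro!: derivative_eq_intros)
        have "1 - w \<le> 1 / (1 + w)" "1 + w \<le> 1 / (1 - w)"
          using w w1 by (simp_all only: pos_le_divide_eq) (simp_all add: pos_le_divide_eq algebra_simps)
        then show "0 \<le> 1 / (1 + w) + 1 / (1 - w) - 2"
          by simp
      qed
      then show ?thesis by simp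
    qed
  qed
  then show ?thesis by simp
qed

text \<open>Equality holds at \<open>k = 0\<close> and \<open>k = 1\<close>. In between, the right
  side divided by \<open>k^2\<close> decreases, by \<open>binary_pinsker\<close>, towards its limit
  \<open>4 * ln 2\<close> at 1.\<close>

lemma square_weighted_ln_ge:
  assumes "0 \<le> k" "k \<le> 1"
  shows "4 * ln 2 * k^2 \<le> (1 + k)^2 * ln (1 + k) + (1 - k)^2 * ln (1 - k :: real)"
proof -
  let ?G = "\<lambda>k::real. (1 + k)^2 * ln (1 + k) + (1 - k)^2 * ln (1 - k)"
  consider "k = 0" | "k = 1" | "0 < k" "k < 1" using assms by linarith
  then show ?thesis
  proof cases
    case 3
    have mono: "?G l / l^2 \<le> ?G k / k^2" if l: "k \<le> l" "l < 1" for l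
    proof (rule DERIV_nonpos_imp_nonincreasing[OF l(1)], intro exI conjI)
      fix z assume z: "k \<le> z" "z \<le> l"
      then have z1: "0 < z" "z < 1" using l 3 by auto
      let ?G' = "2 * (1 + z) * ln (1 + z) + (1 + z) - 2 * (1 - z) * ln (1 - z) - (1 - z)"
      have "(?G has_real_derivative ?G') (at z)"
        using z1 by (auto intro!: derivative_eq_intros simp: power2_eq_square) (simp add: field_simps)
      moreover have "((\<lambda>l. l^2) has_real_derivative 2 * z) (at z)"
        by (auto intro!: derivative_eq_intros)
      ultimately show "((\<lambda>l. ?G l / l^2) has_real_derivative (?G' * z^2 - ?G z * (2 * z)) / (z^2 * z^2)) (at z)"
        using z1 by (intro DERIV_divide) auto
      have "?G' * z^2 - ?G z * (2 * z) =
        2 * z * (z^2 - ((1 + z) * ln (1 + z) + (1 - z) * ln (1 - z)))"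
        by (simp add: algebra_simps power2_eq_square)
      also have "\<dots> \<le> 0"
        using binary_pinsker[of z] z1 by (simp add: mult_le_0_iff)
      finally show "(?G' * z^2 - ?G z * (2 * z)) / (z^2 * z^2) \<le> 0"
        by (simp add: divide_nonpos_nonneg)
    qed
    \<comment> \<open>The term with \<open>ln (1 - l)\<close> is replaced by the lower bound
      \<open>- (1 - l)\<close>, so that the limit at 1 is that of a continuous function.\<close>
    have low: "((1 + l)^2 * ln (1 + l) - (1 - l)) / l^2 \<le> ?G l / l^2" if "k \<le> l" "l < 1" for l
    proof -
      have "nent (1 - l) \<le> 1 - (1 - l)" using nent_le_tangent[of "1 - l" 1] that by simp
      then have "(1 - l) * ((1 - l) * ln (1 - l)) \<ge> (1 - l) * (- l)"
        using that by (intro mult_left_mono) (auto simp: nent_def algebra_simps)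
      moreover have "(1 - l) * l \<le> 1 - l" using that 3 by (simp add: mult_left_le)
      ultimately show ?thesis
        using that 3 by (intro divide_right_mono) (auto simp: power2_eq_square algebra_simps)
    qed
    have "((\<lambda>l::real. ((1 + l)^2 * ln (1 + l) - (1 - l)) / l^2) \<longlongrightarrow>
        ((1 + 1)^2 * ln (1 + 1) - (1 - 1)) / 1^2) (at_left 1)"
      by (intro tendsto_intros) auto
    moreover have "eventually (\<lambda>l. ((1 + l)^2 * ln (1 + l) - (1 - l)) / l^2 \<le> ?G k / k^2) (at_left 1)"
      by (rule eventually_mono[OF eventually_at_left_real[OF 3(2)]])
        (rule order_trans[OF low mono], auto)
    ultimately have "((1 + 1)^2 * ln (1 + 1) - (1 - 1)) / 1^2 \<le> ?G k / k^2"
      by (intro tendsto_upperbound[where F = "at_left 1"]) auto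
    then show ?thesis using 3 by (simp add: pos_le_divide_eq)
  qed auto
qed

text \<open>\<open>W\<close> is the entropy for the Bell input minus that for the product input, in
  nats. It is not monotone, but in the derivative of \<open>W a / a\<close> only
  \<open>ln (1 - 3 * z) - ln (1 - 4 * z)\<close> survives in the numerator. Hence \<open>W\<close>
  can change sign only once, from negative to positive.\<close>

lemma entropy_gap_ratio_mono:
  fixes a b :: real
  defines "W \<equiv> \<lambda>a. 3 * nent a + nent (1 - 3 * a) - (nent (4 * a) + nent (1 - 4 * a))"
  assumes ab: "0 < a" "a \<le> b" "b < 1/4"
  shows "W a / a \<le> W b / b"
proof (rule DERIV_nonneg_imp_nondecreasing[OF ab(2)], intro exI conjI)
  fix z assume "a \<le> z" "z \<le> b"
  then have z: "0 < z" "z < 1/4" using ab by auto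
  let ?W' = "ln z + 8 * ln 2 + 3 * ln (1 - 3 * z) - 4 * ln (1 - 4 * z)"
  have l4: "ln (4 * z) = 2 * ln 2 + ln z"
    using z ln_realpow[of 2 2] by (simp add: ln_mult)
  have "(16 * z - 4) / (1 - 4 * z) = - 4" "(9 * z - 3) / (1 - 3 * z) = - 3"
    using z by (simp_all add: divide_eq_eq)
  then have "(W has_real_derivative ?W') (at z)"
    unfolding W_def nent_def using z
    by (auto intro!: derivative_eq_intros simp: l4)
  then show "((\<lambda>a. W a / a) has_real_derivative (?W' * z - W z * 1) / (z * z)) (at z)"
    using z by (intro DERIV_divide) (auto intro!: derivative_eq_intros)
  have "?W' * z - W z * 1 = ln (1 - 3 * z) - ln (1 - 4 * z)"
    unfolding W_def nent_def l4 by (simp add: algebra_simps)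
  also have "\<dots> \<ge> 0" using z by simp
  finally show "0 \<le> (?W' * z - W z * 1) / (z * z)" using z by simp
qed

section \<open>Entropy of the four output eigenvalues\<close>

lemma ln_16: "ln (16::real) = 4 * ln 2"
  using ln_realpow[of 2 4] by simp

text \<open>The bound 1/2 would be too weak for the estimates below at small
  \<open>a\<close>.\<close>

lemma ln_2_ge: "7/12 \<le> ln (2::real)"
proof -
  have "ln (2::real) = ln (4/3) + ln (3/2)"
    using ln_mult[of "4/3::real" "3/2"] by simp
  moreover have "- ln (4/3) = ln (3/4::real)" "- ln (3/2) = ln (2/3::real)"
    by (simp_all add: ln_div)
  moreover have "ln (3/4::real) \<le> 3/4 - 1" "ln (2/3::real) \<le> 2/3 - 1"
    by (rule ln_le_minus_one; simp)+
  ultimately show ?thesis by simp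
qed

text \<open>
  The spectrum for antipodal Bloch vectors of length \<open>\<surd>y\<close>. The largest eigenvalue \<open>l\<close> is compared with its
  value \<open>1 - 3a\<close> at \<open>y = 0\<close>; the deficit \<open>d\<close> satisfies \<open>a y\<^sup>2 \<le> d \<le> a y\<close>, and the gap \<open>a y - d\<close>, weighted by
  \<open>- ln a\<close>, is what pays for all error terms when \<open>a \<le> 1/16\<close>.
\<close>

lemma antipodal_entropy_le:
  fixes a y l m :: real
  assumes a: "0 < a" "a \<le> 1/4" and y: "0 \<le> y" "y \<le> 1"
    and m: "0 \<le> m" "m \<le> l" and T: "l + m = 1 - 2 * a - 2 * a * y"
    and D: "l * m = (1 - y)^2 * a * (1 - 3 * a)"
  shows "nent (a * (1 + sqrt y)^2) + nent (a * (1 - sqrt y)^2) + nent l + nent m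
    \<le> max (nent (4 * a) + nent (1 - 4 * a)) (3 * nent a + nent (1 - 3 * a))"
proof -
  define d where "d = 1 - 3 * a - l"
  define e where "e = 1 - y"
  have l: "l = 1 - 3 * a - d" and m_eq: "m = a - 2 * a * y + d"
    using T by (auto simp: d_def)
  have e: "0 \<le> e" "e \<le> 1" "y = 1 - e" using y by (auto simp: e_def)
  have l0: "0 \<le> l" using m by simp
  have ay: "0 \<le> a * y" "a * y \<le> a" using a y by (auto simp: mult_left_le)

  \<comment> \<open>Writing the squares as \<open>a * z^2\<close> separates \<open>ln a\<close> from
    a term that \<open>square_weighted_ln_ge\<close> bounds at \<open>k = sqrt y\<close>.\<close>
  have pair: "nent (a * (1 + sqrt y)^2) + nent (a * (1 - sqrt y)^2)
      \<le> - (2 * a + 2 * a * y) * ln a - 8 * a * ln 2 * y"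
  proof -
    let ?k = "sqrt y"
    have k: "0 \<le> ?k" "?k \<le> 1" "?k^2 = y" using y by auto
    have n: "nent (a * z^2) = - (a * z^2) * ln a - 2 * a * (z^2 * ln z)" if "0 \<le> z" for z
      using that a by (cases "z = 0") (auto simp: nent_def ln_mult ln_realpow algebra_simps)
    have "nent (a * (1 + ?k)^2) + nent (a * (1 - ?k)^2) =
      - a * ((1 + ?k)^2 + (1 - ?k)^2) * ln a - 2 * a * ((1 + ?k)^2 * ln (1 + ?k) + (1 - ?k)^2 * ln (1 - ?k))"
      using k by (subst (1 2) n) (auto simp: algebra_simps)
    also have "(1 + ?k)^2 + (1 - ?k)^2 = 2 + 2 * ?k^2" by (simp add: power2_eq_square algebra_simps)
    also have "- a * (2 + 2 * ?k^2) * ln a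
        - 2 * a * ((1 + ?k)^2 * ln (1 + ?k) + (1 - ?k)^2 * ln (1 - ?k))
      \<le> - a * (2 + 2 * ?k^2) * ln a - 2 * a * (4 * ln 2 * ?k^2)"
      using square_weighted_ln_ge[OF k(1,2)] a by (intro diff_left_mono mult_left_mono) auto
    finally show ?thesis using k(3) by (simp add: algebra_simps)
  qed

  \<comment> \<open>The monic quadratic with roots \<open>l\<close> and \<open>m\<close> is
    nonpositive at \<open>1 - 3 * a - a * y\<close>, so this point does not exceed the larger root
    \<open>l\<close>.\<close>
  have d_le: "d \<le> a * y"
  proof -
    define \<mu> where "\<mu> = 1 - 3 * a - a * y"
    have "(\<mu> - l) * (\<mu> - m) = \<mu>^2 - (l + m) * \<mu> + l * m"
      by (simp add: power2_eq_square algebra_simps)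
    also have "\<dots> = - (a * (1 - y) * y * (1 - 4 * a))"
      unfolding T D \<mu>_def by (simp add: power2_eq_square algebra_simps)
    also have "\<dots> \<le> 0" using a y by simp
    finally have "\<not> (0 < \<mu> - l \<and> 0 < \<mu> - m)" by (metis mult_pos_pos not_le)
    then show ?thesis using m by (auto simp: \<mu>_def d_def)
  qed
  have lpos: "0 < 1 - 3 * a" using a by simp

  show ?thesis
  \<comment> \<open>From 1/16 on, \<open>(1 - 3 * a) / a\<close> is at most 16, small enough for the
    Gibbs inequality against the spectrum at \<open>y = 0\<close>. Below 1/16 the comparison is with
    the chord.\<close>
  proof (cases "1/16 \<le> a")
    case True
    have "ln ((1 - 3 * a) / a) \<le> ln 16"
      using True lpos a by (subst ln_le_cancel_iff) (auto simp: field_simps)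
    then have Lam: "ln (1 - 3 * a) - ln a \<le> 4 * ln 2" using lpos a by (simp add: ln_div ln_16)
    have Lam0: "0 \<le> ln (1 - 3 * a) - ln a" using a lpos by simp
    have "d * (ln (1 - 3 * a) - ln a) \<le> a * y * (ln (1 - 3 * a) - ln a)"
      using d_le Lam0 by (intro mult_right_mono)
    also have "\<dots> \<le> a * y * (4 * ln 2)" using Lam ay by (intro mult_left_mono)
    \<comment> \<open>Here \<open>8 * ln 2\<close> is the gain in \<open>pair\<close>, and the 2
      collects the linear terms of the two tangents below.\<close>
    also have "\<dots> \<le> a * y * (8 * ln 2 - 2)"
      using ay ln_2_ge by (intro mult_left_mono) auto
    finally have fin: "d * (ln (1 - 3 * a) - ln a) \<le> a * y * (8 * ln 2 - 2)" .
    have "nent l \<le> - l * ln (1 - 3 * a) + (1 - 3 * a - l)" "nent m \<le> - m * ln a + (a - m)"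
      using nent_le_tangent l0 lpos a m by auto
    then have "nent l + nent m + (- (2 * a + 2 * a * y) * ln a - 8 * a * ln 2 * y)
      \<le> 3 * nent a + nent (1 - 3 * a) + (d * (ln (1 - 3 * a) - ln a) - a * y * (8 * ln 2 - 2))"
      unfolding nent_def[of a] nent_def[of "1 - 3 * a"] l m_eq by (simp add: algebra_simps)
    with pair fin show ?thesis by linarith
  next
    case False
    then have a16: "a \<le> 1/16" by simp
    have lge: "1 - 4 * a \<le> l" using d_le ay by (simp add: l)
    then have l34: "3/4 \<le> l" using a16 by simp
    have mle: "m \<le> 1/4" using T l34 ay a by simp
    have aey: "0 \<le> a * e * y" using a e y by simp
    \<comment> \<open>At \<open>1 - 3 * a - a * y^2\<close> the same quadratic takes a square as its
      value, and this point exceeds \<open>m\<close>; so it is not below \<open>l\<close>.\<close>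
    have dge: "a * y^2 \<le> d"
    proof -
      define \<mu> where "\<mu> = 1 - 3 * a - a * y^2"
      have "(\<mu> - l) * (\<mu> - m) = \<mu>^2 - (l + m) * \<mu> + l * m"
        by (simp add: power2_eq_square algebra_simps)
      also have "\<dots> = (a * y * (1 - y))^2"
        unfolding T D \<mu>_def by (simp add: power2_eq_square algebra_simps)
      also have "\<dots> \<ge> 0" by simp
      finally have "0 \<le> (\<mu> - l) * (\<mu> - m)" .
      moreover have "0 < \<mu> - m"
      proof -
        have "a * y^2 \<le> a * 1" using a y by (intro mult_left_mono) (auto simp: power_le_one)
        then show ?thesis using mle a16 by (simp add: \<mu>_def)
      qed
      ultimately show ?thesis by (auto simp: \<mu>_def d_def zero_le_mult_iff)
    qed
    have d0: "0 \<le> d" using dge a y by (meson mult_nonneg_nonneg order_trans less_imp_le zero_le_power2)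
    \<comment> \<open>\<open>k\<close> measures how far \<open>l\<close> falls below its value at
      \<open>y = 0\<close>. The product condition becomes \<open>m = a * e^2 * k\<close> with
      \<open>k\<close> close to 1.\<close>
    define k where "k = (1 - 3 * a) / l"
    have k1: "1 \<le> k" using l34 d0 by (simp add: k_def l)
    have k2: "k \<le> 13/12" using l34 lge a16 by (simp add: k_def divide_le_eq)
    have k3: "k - 1 \<le> y / 12"
    proof -
      have "k - 1 = d / l" using l34 by (simp add: k_def l field_simps)
      also have "\<dots> \<le> (a * y) / l" using d_le l34 by (intro divide_right_mono) auto
      also have "\<dots> \<le> (1/16 * y) / (3/4)" using l34 ay a16 y
        by (intro frac_le mult_right_mono) auto
      finally show ?thesis by simp
    qed
    have mk: "m = a * e^2 * k" using D l34 by (simp add: k_def e_def field_simps)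
    \<comment> \<open>In \<open>ln m = ln a + 2 * ln e + ln k\<close> the last term only helps, and
      \<open>nent e \<le> 1 - e = y\<close>. The factor 13/6 is twice the bound on
      \<open>k\<close>.\<close>
    have mbound: "nent m \<le> - m * ln a + 13/6 * (a * e * y)"
    proof (cases "e = 0")
      case True
      then show ?thesis by (simp add: mk)
    next
      case False
      have "ln m = ln a + 2 * ln e + ln k"
        using False e a k1 by (simp add: mk ln_mult ln_realpow)
      then have "nent m = - m * ln a + 2 * a * e * k * nent e - m * ln k"
        by (simp add: nent_def mk power2_eq_square algebra_simps)
      also have "\<dots> \<le> - m * ln a + 2 * a * e * k * nent e" using m k1 by simp
      also have "\<dots> \<le> - m * ln a + 2 * a * e * k * y"
        using nent_le_tangent[of e 1] a e k1 by (intro add_left_mono mult_left_mono) auto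
      also have "2 * a * e * k * y = (2 * k) * (a * e * y)" by simp
      also have "\<dots> \<le> (13/6) * (a * e * y)" using k2 aey by (intro mult_right_mono) auto
      finally show ?thesis by simp
    qed
    \<comment> \<open>Tangents at the endpoint values \<open>1 - 4 * a\<close> and
      \<open>1 - 3 * a\<close> of \<open>l\<close>, weighted like the chord. The factor 2/3 comes
      from \<open>a - d \<le> 2 * a * e\<close> and
      \<open>- ln (1 - 4 * a) \<le> 1/3\<close>.\<close>
    have lbound: "nent l \<le> y * nent (1 - 4 * a) + (1 - y) * nent (1 - 3 * a)
        + 2/3 * (a * e * y) - (a * y - d)"
    proof -
      have p4: "0 < 1 - 4 * a" using a16 by simp
      have "nent l = y * nent l + (1 - y) * nent l" by (simp add: algebra_simps)
      also have "\<dots> \<le> y * (- l * ln (1 - 4 * a) + (1 - 4 * a - l))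
          + (1 - y) * (- l * ln (1 - 3 * a) + (1 - 3 * a - l))"
        using y l0 lpos p4 by (intro add_mono mult_left_mono nent_le_tangent) auto
      also have "\<dots> = y * nent (1 - 4 * a) + (1 - y) * nent (1 - 3 * a)
          + (a - d) * y * (- ln (1 - 4 * a)) + (1 - y) * d * ln (1 - 3 * a) - (a * y - d)"
        by (simp add: nent_def l algebra_simps)
      also have "(1 - y) * d * ln (1 - 3 * a) \<le> 0"
        using y d0 a lpos by (intro mult_nonneg_nonpos) auto
      also have "(a - d) * y * (- ln (1 - 4 * a)) \<le> (2 * a * e) * y * (1/3)"
      proof (intro mult_mono)
        have "a - d \<le> a * (1 - y^2)" using dge by (simp add: algebra_simps)
        also have "1 - y^2 = e * (1 + y)" by (simp add: e_def power2_eq_square algebra_simps)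
        also have "a * (e * (1 + y)) \<le> a * (e * 2)" using a e y by (intro mult_left_mono) auto
        finally show "a - d \<le> 2 * a * e" by simp
        have "- ln (1 - 4 * a) = ln (1 / (1 - 4 * a))" using p4 by (simp add: ln_div)
        also have "\<dots> \<le> 1 / (1 - 4 * a) - 1" using p4 by (intro ln_le_minus_one) auto
        also have "\<dots> \<le> 1/3" using a16 by (simp add: field_simps)
        finally show "- ln (1 - 4 * a) \<le> 1/3" .
      qed (use a e y p4 in auto)
      finally show ?thesis by simp
    qed
    have gap: "a * y - d = a * e - m" by (simp add: m_eq e_def algebra_simps)
    have gap_ge: "11/12 * (a * e * y) \<le> a * y - d"
    proof -
      have "a * e - m = a * e * (y - (k - 1) * e)"
        by (simp add: mk e_def power2_eq_square algebra_simps)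
      also have "\<dots> \<ge> a * e * (y - y / 12)"
      proof (intro mult_left_mono diff_left_mono)
        have "(k - 1) * e \<le> (y / 12) * 1" using k3 k1 e y by (intro mult_mono) auto
        then show "(k - 1) * e \<le> y / 12" by simp
      qed (use a e in auto)
      finally show ?thesis by (simp add: gap)
    qed
    have "ln a \<le> - ln 16"
    proof -
      have "ln a \<le> ln (1/16)" using a a16 by (subst ln_le_cancel_iff) auto
      then show ?thesis by (simp add: ln_div)
    qed
    then have lna: "7/3 \<le> - ln a" using ln_2_ge by (simp add: ln_16)
    \<comment> \<open>The errors 13/6 from \<open>m\<close> and 2/3 from \<open>l\<close> add up to
      17/6. They are paid by the gap, at least 11/12 of \<open>a * e * y\<close>, times
      \<open>1 - ln a \<ge> 10/3\<close>.\<close>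
    have "17/6 * (a * e * y) \<le> 11/12 * (a * e * y) * (10/3)" using aey by simp
    also have "\<dots> \<le> (a * y - d) * (1 - ln a)"
      using gap_ge lna aey by (intro mult_mono) auto
    finally have fin: "17/6 * (a * e * y) \<le> (a * y - d) * (1 - ln a)" .
    have l4: "ln (4 * a) = 2 * ln 2 + ln a"
      using a ln_realpow[of 2 2] by (simp add: ln_mult)
    have "nent (a * (1 + sqrt y)^2) + nent (a * (1 - sqrt y)^2) + nent l + nent m
      \<le> y * (nent (4 * a) + nent (1 - 4 * a)) + (1 - y) * (3 * nent a + nent (1 - 3 * a))"
    proof -
      have "y * nent (4 * a) + (1 - y) * (3 * nent a) =
        - (3 * a + a * y) * ln a - 8 * a * ln 2 * y"
        unfolding nent_def l4 by (simp add: algebra_simps)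
      moreover have "- m * ln a = - (a - a * y) * ln a + (a * y - d) * ln a"
        by (simp add: m_eq algebra_simps)
      ultimately show ?thesis
        using pair mbound lbound fin by (simp add: algebra_simps)
    qed
    also have "\<dots> \<le> y * max (nent (4 * a) + nent (1 - 4 * a)) (3 * nent a + nent (1 - 3 * a))
        + (1 - y) * max (nent (4 * a) + nent (1 - 4 * a)) (3 * nent a + nent (1 - 3 * a))"
      using y by (intro add_mono mult_left_mono) auto
    finally show ?thesis by (simp add: algebra_simps)
  qed
qed

text \<open>For \<open>s = u + v > 1/2\<close> the comparison is with the antipodal input of equal
  \<open>s\<close>: it has the largest possible \<open>u * v\<close>, which makes both pairs of
  eigenvalues more balanced. For \<open>s \<le> 1/2\<close> the larger of \<open>l\<close> and
  \<open>m\<close> is at least \<open>1 - 3 * a\<close>, and the Gibbs inequality suffices.\<close>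

lemma product_weights_entropy_le:
  fixes a p q l m :: real
  defines "u \<equiv> p * (1 - q)" and "v \<equiv> (1 - p) * q"
  assumes a: "0 < a" "a \<le> 1/4" and p: "0 \<le> p" "p \<le> 1" and q: "0 \<le> q" "q \<le> 1"
    and nn: "0 \<le> l" "0 \<le> m" and T: "l + m = 1 - 4 * a * (u + v)"
    and D: "l * m = 16 * a * (1 - 3 * a) * (u * v)"
  shows "nent (4 * a * u) + nent (4 * a * v) + nent l + nent m
    \<le> max (nent (4 * a) + nent (1 - 4 * a)) (3 * nent a + nent (1 - 3 * a))"
proof -
  define s where "s = u + v"
  have uv: "0 \<le> u" "0 \<le> v" using p q by (auto simp: u_def v_def)
  have a3: "0 < 1 - 3 * a" using a by simp
  have s1: "1 - s = p * q + (1 - p) * (1 - q)" by (simp add: s_def u_def v_def algebra_simps)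
  have "0 \<le> 1 - s" unfolding s1 using p q by simp
  then have s_le: "s \<le> 1" by simp
  have b1: "4 * (u * v) \<le> s^2"
    using zero_le_power2[of "u - v"] by (simp add: s_def power2_eq_square algebra_simps)
  \<comment> \<open>\<open>u * v\<close> is also the product of \<open>p * q\<close> and
    \<open>(1 - p) * (1 - q)\<close>, whose sum is \<open>1 - s\<close>. Equality means
    \<open>p + q = 1\<close>.\<close>
  have b2: "4 * (u * v) \<le> (1 - s)^2"
    unfolding s1 using zero_le_power2[of "p * q - (1 - p) * (1 - q)"]
    by (simp add: u_def v_def power2_eq_square algebra_simps)
  show ?thesis
  proof (cases "s \<le> 1/2")
    case True
    define L M where "L = max l m" and "M = min l m"
    have LM: "L + M = l + m" "L * M = l * m" "M \<le> L" "0 \<le> M" "nent l + nent m = nent L + nent M"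
      using nn by (auto simp: L_def M_def max_def min_def)
    \<comment> \<open>For \<open>s = 1/2\<close> and \<open>u * v = 1/16\<close> the two eigenvalues
      are \<open>1 - 3 * a\<close> and \<open>a\<close>; a larger sum and a smaller product push
      \<open>L\<close> up.\<close>
    have "1 - 3 * a \<le> L"
    proof -
      have "a * s \<le> a * (1/2)" using True a by (intro mult_left_mono) auto
      then have T2: "1 - 2 * a \<le> L + M" using T LM by (simp add: s_def)
      have "s^2 \<le> (1/2)^2" using True uv by (intro power_mono) (auto simp: s_def)
      then have "4 * (u * v) \<le> 1/4" using b1 by (simp add: power2_eq_square)
      then have "4 * a * (1 - 3 * a) * (4 * (u * v)) \<le> 4 * a * (1 - 3 * a) * (1/4)"
        using a a3 by (intro mult_left_mono) auto
      then have D2: "L * M \<le> a * (1 - 3 * a)" using D LM by (simp add: algebra_simps)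
      have "(1 - 2 * a) * L \<le> (L + M) * L" using T2 LM by (intro mult_right_mono) auto
      then have "0 \<le> (L - a) * (L - (1 - 3 * a))" using D2 by (simp add: algebra_simps)
      moreover have "a \<le> L" using T2 LM a by linarith
      \<comment> \<open>\<open>L = a\<close> is possible only for \<open>a = 1/4\<close>, where
        \<open>a = 1 - 3 * a\<close>.\<close>
      ultimately show ?thesis using a T2 LM(3)
        by (cases "L = a") (auto simp: zero_le_mult_iff)
    qed
    \<comment> \<open>The four tangent bounds sum to the Bell value plus exactly this
      product.\<close>
    then have "(1 - 3 * a - L) * (ln (1 - 3 * a) - ln a) \<le> 0"
      using a a3 by (intro mult_nonpos_nonneg) auto
    moreover have "nent (4 * a * u) \<le> - (4 * a * u) * ln a + (a - 4 * a * u)"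
      "nent (4 * a * v) \<le> - (4 * a * v) * ln a + (a - 4 * a * v)"
      "nent M \<le> - M * ln a + (a - M)"
      "nent L \<le> - L * ln (1 - 3 * a) + (1 - 3 * a - L)"
      using nent_le_tangent[of "4 * a * u" a] nent_le_tangent[of "4 * a * v" a]
        nent_le_tangent[of M a] nent_le_tangent[of L "1 - 3 * a"] a a3 uv LM by auto
    moreover have M: "M = 1 - 4 * a * u - 4 * a * v - L" using LM T by (simp add: algebra_simps)
    have "M * ln a = ln a - 4 * a * u * ln a - 4 * a * v * ln a - L * ln a"
      unfolding M by (simp add: algebra_simps)
    moreover have "M + 4 * a * u + 4 * a * v + L = 1" using M by simp
    ultimately have "nent (4 * a * u) + nent (4 * a * v) + nent L + nent M
      \<le> 3 * nent a + nent (1 - 3 * a)"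
      unfolding nent_def[of a] nent_def[of "1 - 3 * a"] by (simp add: algebra_simps)
    then show ?thesis using LM by linarith
  next
    case False
    \<comment> \<open>The antipodal choice \<open>p = (1 + sqrt y) / 2\<close>,
      \<open>q = 1 - p\<close> has the same \<open>u + v\<close>; \<open>l'\<close> and
      \<open>m'\<close> below are its other two eigenvalues, with discriminant
      \<open>\<Delta>\<close>.\<close>
    define y where "y = 2 * s - 1"
    have y: "0 \<le> y" "y \<le> 1" using False s_le by (auto simp: y_def)
    have s: "s = (1 + y) / 2" by (simp add: y_def)
    define t where "t = 1 - 2 * a - 2 * a * y"
    define \<Delta> where "\<Delta> = (1 - 4 * a) * (1 - 4 * a + 4 * a * (y * (1 - y)))"
    have \<Delta>0: "0 \<le> \<Delta>" using a y by (simp add: \<Delta>_def)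
    have \<Delta>: "\<Delta> = t^2 - 4 * ((1 - y)^2 * a * (1 - 3 * a))"
      by (simp add: \<Delta>_def t_def power2_eq_square algebra_simps)
    define l' m' where "l' = (t + sqrt \<Delta>) / 2" and "m' = (t - sqrt \<Delta>) / 2"
    have t: "t = l + m" using T unfolding s_def[symmetric] s by (simp add: t_def field_simps)
    have tt: "l' + m' = t" by (simp add: l'_def m'_def field_simps)
    have "l' * m' = (t^2 - (sqrt \<Delta>)^2) / 4"
      by (simp add: l'_def m'_def power2_eq_square algebra_simps)
    then have dd: "l' * m' = (1 - y)^2 * a * (1 - 3 * a)" using \<Delta>0 by (simp add: \<Delta>)
    have "\<Delta> \<le> t^2" using a a3 by (simp add: \<Delta>)
    then have "sqrt \<Delta> \<le> t" using t nn by (intro real_le_lsqrt) auto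
    then have m': "0 \<le> m'" "m' \<le> l'" using \<Delta>0 by (auto simp: l'_def m'_def)
    have yy: "16 * (u * v) \<le> (1 - y)^2" using b2 by (simp add: s power2_eq_square algebra_simps)
    have "nent l + nent m \<le> nent l' + nent m'"
    proof (rule nent_add_mono_product)
      have "16 * (u * v) * (a * (1 - 3 * a)) \<le> (1 - y)^2 * (a * (1 - 3 * a))"
        using yy a a3 by (intro mult_right_mono) auto
      then show "l * m \<le> l' * m'" unfolding D dd by (simp add: algebra_simps)
    qed (use nn m' t tt in auto)
    moreover have "nent (4 * a * u) + nent (4 * a * v)
      \<le> nent (a * (1 + sqrt y)^2) + nent (a * (1 - sqrt y)^2)"
    proof (rule nent_add_mono_product)
      have k: "(sqrt y)^2 = y" using y by simp
      have "4 * a * u + 4 * a * v = 4 * a * s" by (simp add: s_def algebra_simps)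
      also have "\<dots> = 2 * a * (1 + (sqrt y)^2)" unfolding k s by (simp add: field_simps)
      also have "\<dots> = a * (1 + sqrt y)^2 + a * (1 - sqrt y)^2"
        by (simp add: power2_eq_square algebra_simps)
      finally show "4 * a * u + 4 * a * v = a * (1 + sqrt y)^2 + a * (1 - sqrt y)^2" .
      have "4 * a * u * (4 * a * v) = a^2 * (16 * (u * v))" by (simp add: power2_eq_square)
      also have "\<dots> \<le> a^2 * (1 - (sqrt y)^2)^2" unfolding k using yy by (intro mult_left_mono) auto
      also have "\<dots> = a * (1 + sqrt y)^2 * (a * (1 - sqrt y)^2)"
        by (simp add: power2_eq_square algebra_simps)
      finally show "4 * a * u * (4 * a * v) \<le> a * (1 + sqrt y)^2 * (a * (1 - sqrt y)^2)" .
    qed (use uv a in auto)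
    ultimately show ?thesis
      using antipodal_entropy_le[OF a y m'] tt dd by (simp add: t_def)
  qed
qed

section \<open>Von Neumann entropy of Gram matrices\<close>

definition root_entropy :: "complex poly \<Rightarrow> real" where
  "root_entropy p = (\<Sum>l | poly p l = 0. real (order l p) * eta (Re l))"

lemma vn_entropy_root_entropy: "vn_entropy A = root_entropy (char_poly A)"
  by (simp add: vn_entropy_def root_entropy_def)

text \<open>Root orders add up under multiplication. Both sums are first extended to all roots of
  the product, where a non-root of a factor has order 0.\<close>

lemma root_entropy_mult:
  assumes "p \<noteq> 0" "q \<noteq> 0"
  shows "root_entropy (p * q) = root_entropy p + root_entropy q"
proof -
  let ?R = "{l. poly (p * q) l = 0}"
  have fin: "finite ?R" using assms by (intro poly_roots_finite) simp
  have *: "root_entropy r = (\<Sum>l\<in>?R. real (order l r) * eta (Re l))" if "{l. poly r l = 0} \<subseteq> ?R" for r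
    unfolding root_entropy_def
    by (rule sum.mono_neutral_left[OF fin that]) (auto simp: order_0I)
  have "root_entropy (p * q) = (\<Sum>l\<in>?R. real (order l p) * eta (Re l) + real (order l q) * eta (Re l))"
    unfolding root_entropy_def using assms
    by (intro sum.cong) (auto simp: order_mult algebra_simps)
  also have "\<dots> = root_entropy p + root_entropy q"
    by (subst (1 2) *) (auto simp: sum.distrib)
  finally show ?thesis .
qed

lemma root_entropy_linear: "root_entropy [:- l, 1:] = eta (Re l)"
proof -
  have "{z. poly [:- l, 1:] z = 0} = {l}" by auto
  moreover have "order l [:- l, 1:] = 1" using order_power_n_n[of l 1] by simp
  ultimately show ?thesis by (simp add: root_entropy_def)
qed

lemma root_entropy_1: "root_entropy 1 = 0"
  by (simp add: root_entropy_def)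

lemma root_entropy_prod_list:
  "root_entropy (\<Prod>l\<leftarrow>ls. [:- l, 1:]) = (\<Sum>l\<leftarrow>ls. eta (Re l))"
proof (induction ls)
  case (Cons l ls)
  have "(\<Prod>l\<leftarrow>ls. [:- l, 1:]) \<noteq> 0" by (auto simp: prod_list_zero_iff)
  then show ?case using Cons by (simp only: list.map prod_list.Cons sum_list.Cons)
      (subst root_entropy_mult, auto simp: root_entropy_linear simp del: mult_pCons_left)
qed (simp add: root_entropy_1)

text \<open>Zero eigenvalues carry no entropy, so matrices of different sizes become
  comparable.\<close>

lemma root_entropy_X_power: "root_entropy ([:0, 1:] ^ n) = 0"
proof (induction n)
  case (Suc n)
  then show ?case
    using root_entropy_linear[of 0]
    by (simp only: power_Suc) (subst root_entropy_mult, auto simp: eta_def simp del: mult_pCons_left)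
qed (simp add: root_entropy_1)

text \<open>Sylvester's identity. One block matrix \<open>M\<close> becomes block triangular by a
  factor on the right, exposing \<open>A * B\<close>, and by a factor on the left, exposing
  \<open>B * A\<close>; then take determinants.\<close>

lemma char_poly_mult_commute:
  fixes A B :: "'a :: idom mat"
  assumes A: "A \<in> carrier_mat n m" and B: "B \<in> carrier_mat m n"
  shows "[:0, 1:] ^ m * char_poly (A * B) = [:0, 1:] ^ n * char_poly (B * A)"
proof -
  let ?l = "map_mat (\<lambda>a::'a. [:a:])"
  let ?X = "[:0, 1::'a:]"
  define A' B' where "A' = ?l A" and "B' = ?l B"
  have A': "A' \<in> carrier_mat n m" and B': "B' \<in> carrier_mat m n" using A B by (auto simp: A'_def B'_def)
  define M where "M = four_block_mat (?X \<cdot>\<^sub>m 1\<^sub>m n) A' B' (1\<^sub>m m)"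
  have M: "M \<in> carrier_mat (n + m) (n + m)" unfolding M_def using A' B' by auto
  have cp: "char_poly_matrix (C * D) = ?X \<cdot>\<^sub>m 1\<^sub>m k - ?l C * ?l D"
    if "C \<in> carrier_mat k j" "D \<in> carrier_mat j k" for C D :: "'a mat" and j k
    using that unfolding char_poly_matrix_def map_poly_mult(1)[OF that, symmetric]
    by (intro eq_matI) auto
  let ?N = "four_block_mat (1\<^sub>m n) (0\<^sub>m n m) (- B') (1\<^sub>m m)"
  have N: "?N \<in> carrier_mat (n + m) (n + m)" using B' by auto
  have "M * ?N = four_block_mat (char_poly_matrix (A * B)) A' (0\<^sub>m m n) (1\<^sub>m m)"
    unfolding M_def cp[OF A B] A'_def[symmetric] B'_def[symmetric]
    by (subst mult_four_block_mat[of _ n n _ m _ m _ _ n _ m]) (use A' B' in \<open>auto simp: minus_add_uminus_mat[symmetric]\<close>)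
  moreover have "det ?N = 1"
    by (subst det_four_block_mat_upper_right_zero[of _ n _ m]) (use B' in auto)
  moreover have "det (four_block_mat (char_poly_matrix (A * B)) A' (0\<^sub>m m n) (1\<^sub>m m)) = char_poly (A * B)"
    by (subst det_four_block_mat_lower_left_zero[of _ n _ m]) (use A B A' in \<open>auto simp: char_poly_def\<close>)
  ultimately have 1: "det M = char_poly (A * B)"
    using det_mult[OF M N] by simp
  let ?K = "four_block_mat (1\<^sub>m n) (0\<^sub>m n m) (- B') (?X \<cdot>\<^sub>m 1\<^sub>m m)"
  have K: "?K \<in> carrier_mat (n + m) (n + m)" using B' by auto
  have "?K * M = four_block_mat (?X \<cdot>\<^sub>m 1\<^sub>m n) A' (0\<^sub>m m n) (char_poly_matrix (B * A))"
    unfolding M_def cp[OF B A] A'_def[symmetric] B'_def[symmetric]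
    by (subst mult_four_block_mat[of _ n n _ m _ m _ _ n _ m]) (use A' B' in \<open>auto simp: minus_add_uminus_mat[symmetric]\<close>)
  moreover have "det ?K = ?X ^ m"
    by (subst det_four_block_mat_upper_right_zero[of _ n _ m]) (use B' in auto)
  moreover have "det (four_block_mat (?X \<cdot>\<^sub>m 1\<^sub>m n) A' (0\<^sub>m m n) (char_poly_matrix (B * A)))
      = ?X ^ n * char_poly (B * A)"
    by (subst det_four_block_mat_lower_left_zero[of _ n _ m]) (use A B A' in \<open>auto simp: char_poly_def\<close>)
  ultimately show ?thesis using 1 det_mult[OF K M] by simp
qed

lemma char_poly_neq_0: "A \<in> carrier_mat n n \<Longrightarrow> char_poly A \<noteq> 0"
  using degree_monic_char_poly[of A n] by auto

lemma vn_entropy_mult_commute: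
  assumes A: "A \<in> carrier_mat n m" and B: "B \<in> carrier_mat m n"
  shows "vn_entropy (A * B) = vn_entropy (B * A)"
proof -
  have "char_poly (A * B) \<noteq> 0" "char_poly (B * A) \<noteq> 0"
    using A B by (auto intro!: char_poly_neq_0)
  then have "vn_entropy (A * B) = root_entropy ([:0, 1:] ^ m * char_poly (A * B))"
    "vn_entropy (B * A) = root_entropy ([:0, 1:] ^ n * char_poly (B * A))"
    by (auto simp: vn_entropy_root_entropy root_entropy_mult root_entropy_X_power simp del: mult_pCons_left)
  then show ?thesis by (simp only: char_poly_mult_commute[OF A B])
qed

section \<open>Adjoints, the spectral theorem and entropy bounds by the diagonal\<close>

definition dagger :: "complex mat \<Rightarrow> complex mat" where
  "dagger A = mat (dim_col A) (dim_row A) (\<lambda>(i, j). cnj (A $$ (j, i)))"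

lemma dagger_carrier [simp]: "A \<in> carrier_mat n m \<Longrightarrow> dagger A \<in> carrier_mat m n"
  by (auto simp: dagger_def)

lemma dagger_dim [simp]: "dim_row (dagger A) = dim_col A" "dim_col (dagger A) = dim_row A"
  by (auto simp: dagger_def)

lemma dagger_index [simp]:
  "i < dim_col A \<Longrightarrow> j < dim_row A \<Longrightarrow> dagger A $$ (i, j) = cnj (A $$ (j, i))"
  by (auto simp: dagger_def)

lemma dagger_dagger [simp]: "dagger (dagger A) = A"
  by (rule eq_matI) auto

lemma dagger_one [simp]: "dagger (1\<^sub>m n) = 1\<^sub>m n"
  by (rule eq_matI) auto

lemma mat_mult_index:
  "A \<in> carrier_mat n m \<Longrightarrow> B \<in> carrier_mat m k \<Longrightarrow> i < n \<Longrightarrow> j < k \<Longrightarrow>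
    (A * B) $$ (i, j) = (\<Sum>l<m. A $$ (i, l) * B $$ (l, j))"
  by (auto simp: scalar_prod_def atLeast0LessThan)

lemma mult_carrier_square:
  "A \<in> carrier_mat n n \<Longrightarrow> B \<in> carrier_mat n n \<Longrightarrow> A * B \<in> carrier_mat n n"
  by simp

lemma dagger_mult:
  assumes "A \<in> carrier_mat n m" "B \<in> carrier_mat m k"
  shows "dagger (A * B) = dagger B * dagger A"
proof (rule eq_matI)
  fix i j assume "i < dim_row (dagger B * dagger A)" "j < dim_col (dagger B * dagger A)"
  then have ij: "i < k" "j < n" using assms by auto
  then show "dagger (A * B) $$ (i, j) = (dagger B * dagger A) $$ (i, j)"
    using assms
    by (simp add: mat_mult_index[of _ n m _ k] mat_mult_index[of _ k m _ n] cnj_sum mult.commute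
        del: index_mult_mat(1))
qed (use assms in auto)

lemma dagger_gram:
  assumes "G \<in> carrier_mat n m"
  shows "dagger (G * dagger G) = G * dagger G"
  using dagger_mult[OF assms dagger_carrier[OF assms]] by simp

lemma gram_index:
  assumes "G \<in> carrier_mat n m" "i < n" "j < n"
  shows "(G * dagger G) $$ (i, j) = (\<Sum>k<m. G $$ (i, k) * cnj (G $$ (j, k)))"
  using assms mat_mult_index[OF assms(1) dagger_carrier[OF assms(1)] assms(2,3)] by auto

text \<open>The witness is the Householder reflection exchanging \<^term>\<open>v\<close> and the first basis vector.\<close>

lemma reflection_to_unit_vector:
  fixes v :: "nat \<Rightarrow> complex"
  assumes n: "0 < n" and v1: "(\<Sum>i<n. v i * cnj (v i)) = 1" and v0: "cnj (v 0) = v 0"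
  shows "\<exists>W \<in> carrier_mat n n. dagger W = W \<and> W * W = 1\<^sub>m n \<and> (\<forall>i<n. W $$ (i, 0) = v i)"
proof -
  define w where "w i = v i - (if i = 0 then 1 else 0)" for i
  define N where "N = (\<Sum>i<n. w i * cnj (w i))"
  define t where "t = 2 / N"
  have N: "N = 2 - 2 * v 0"
  proof -
    have "N = (\<Sum>i<n. v i * cnj (v i) + (if i = 0 then 1 - v i - cnj (v i) else 0))"
      unfolding N_def w_def by (intro sum.cong) (auto simp: algebra_simps)
    also have "\<dots> = 1 + (1 - v 0 - cnj (v 0))" unfolding sum.distrib v1 using n by simp
    finally show ?thesis using v0 by simp
  qed
  have cN: "cnj N = N" by (simp add: N v0)
  then have ct: "cnj t = t" by (simp add: t_def)
  \<comment> \<open>Division by zero gives \<open>t = 0\<close> when \<open>N = 0\<close>, so the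
    identity needs no case distinction.\<close>
  have tN: "t * (t * N) = 2 * t" by (simp add: t_def)
  define W where "W = mat n n (\<lambda>(i, j). (if i = j then 1 else 0) - t * w i * cnj (w j))"
  have W: "W \<in> carrier_mat n n" by (simp add: W_def)
  have "dagger W = W" by (rule eq_matI) (auto simp: W_def ct)
  moreover have "W * W = 1\<^sub>m n"
  proof (rule eq_matI)
    fix i j assume "i < dim_row (1\<^sub>m n :: complex mat)" "j < dim_col (1\<^sub>m n :: complex mat)"
    then have ij: "i < n" "j < n" by auto
    have "(W * W) $$ (i, j) = (\<Sum>k<n. W $$ (i, k) * W $$ (k, j))"
      by (rule mat_mult_index[OF W W ij])
    also have "\<dots> = (\<Sum>k<n. (if i = k then (if k = j then 1 else 0) - t * w k * cnj (w j) else 0)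
        - (if k = j then t * w i * cnj (w k) else 0) + t * t * w i * cnj (w j) * (w k * cnj (w k)))"
      using ij by (intro sum.cong) (auto simp: W_def algebra_simps)
    also have "\<dots> = (if i = j then 1 else 0) - t * w i * cnj (w j) - t * w i * cnj (w j)
        + t * t * w i * cnj (w j) * N"
      unfolding sum.distrib sum_subtractf N_def sum_distrib_left[symmetric] using ij by simp
    also have "t * t * w i * cnj (w j) * N = (t * (t * N)) * w i * cnj (w j)" by simp
    also have "\<dots> = 2 * t * w i * cnj (w j)" unfolding tN ..
    finally show "(W * W) $$ (i, j) = 1\<^sub>m n $$ (i, j)" using ij by (auto simp: algebra_simps)
  qed (use W in auto)
  moreover have "W $$ (i, 0) = v i" if i: "i < n" for i
  proof (cases "N = 0")
    case True
    have "complex_of_real (\<Sum>i<n. (cmod (w i))^2) = 0"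
      using True by (simp only: N_def complex_norm_square of_real_sum)
    then have "(\<Sum>i<n. (cmod (w i))^2) = 0" by (simp only: of_real_eq_0_iff)
    then have "w i = 0" using i by (subst (asm) sum_nonneg_eq_0_iff) auto
    then show ?thesis using i n by (simp add: W_def w_def)
  next
    case False
    \<comment> \<open>Here the reality of \<open>v 0\<close> enters: \<open>w 0\<close> is real and
      \<open>N = - 2 * w 0\<close>.\<close>
    have "t * cnj (w 0) = -1" using False by (simp add: t_def w_def v0 N divide_eq_eq)
    then have "t * w i * cnj (w 0) = - w i" by (metis mult.commute mult.left_commute mult_minus1_right)
    then show ?thesis using i n by (simp add: W_def) (simp add: w_def)
  qed
  ultimately show ?thesis using W by blast
qed

lemma unit_eigenvector_exists:
  assumes A: "A \<in> carrier_mat n n" and n: "0 < n"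
  obtains v :: "nat \<Rightarrow> complex" and l where "(\<Sum>i<n. v i * cnj (v i)) = 1" "cnj (v 0) = v 0"
    "\<And>i. i < n \<Longrightarrow> (\<Sum>j<n. A $$ (i, j) * v j) = l * v i"
proof -
  have "degree (char_poly A) \<noteq> 0" using degree_monic_char_poly[OF A] n by simp
  then obtain l where "poly (char_poly A) l = 0"
    using fundamental_theorem_of_algebra[of "char_poly A"] by (auto simp: constant_degree)
  then have "eigenvalue A l" using eigenvalue_root_char_poly[OF A] by simp
  then obtain x where x: "x \<in> carrier_vec n" "x \<noteq> 0\<^sub>v n" "A *\<^sub>v x = l \<cdot>\<^sub>v x"
    using A by (auto simp: eigenvalue_def eigenvector_def)
  define R where "R = (\<Sum>i<n. (cmod (x $ i))^2)"
  obtain i where i: "i < n" "x $ i \<noteq> 0" using x by (metis carrier_vecD eq_vecI index_zero_vec)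
  have "0 < R" unfolding R_def by (rule sum_pos2[of _ i]) (use i in auto)
  \<comment> \<open>This scalar normalizes the eigenvector and makes its first entry real, as the
    reflection requires.\<close>
  define z where "z = (if x $ 0 = 0 then 1 else cnj (x $ 0) / cmod (x $ 0)) / sqrt R"
  have "cmod z = 1 / sqrt R" using \<open>0 < R\<close> by (auto simp: z_def norm_divide)
  then have "(cmod z)^2 = 1 / R" using \<open>0 < R\<close> by (simp add: power_divide)
  then have zz: "z * cnj z = 1 / R" by (simp flip: complex_norm_square)
  have "(\<Sum>i<n. z * x $ i * cnj (z * x $ i)) = z * cnj z * (\<Sum>i<n. x $ i * cnj (x $ i))"
    by (simp add: sum_distrib_left mult_ac)
  also have "(\<Sum>i<n. x $ i * cnj (x $ i)) = R" by (simp only: R_def complex_norm_square of_real_sum)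
  finally have 1: "(\<Sum>i<n. z * x $ i * cnj (z * x $ i)) = 1" using zz \<open>0 < R\<close> by simp
  have 2: "cnj (z * x $ 0) = z * x $ 0" by (auto simp: z_def)
  have 3: "(\<Sum>j<n. A $$ (i, j) * (z * x $ j)) = l * (z * x $ i)" if "i < n" for i
  proof -
    have "(\<Sum>j<n. A $$ (i, j) * x $ j) = (A *\<^sub>v x) $ i"
      using that A x(1) by (auto simp: scalar_prod_def atLeast0LessThan)
    also have "\<dots> = l * x $ i" using x that by simp
    finally have "z * (\<Sum>j<n. A $$ (i, j) * x $ j) = z * (l * x $ i)" by simp
    then show ?thesis by (simp add: sum_distrib_left mult_ac)
  qed
  show ?thesis by (rule that[OF 1 2 3])
qed

text \<open>Deflation: a reflection \<open>W\<close> takes the first basis vector to a unit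
  eigenvector, so the first column of \<open>C\<close> is a multiple of that basis vector.
  Hermiticity clears the first row as well, and induction handles the remaining block.\<close>

lemma hermitian_spectral:
  assumes "A \<in> carrier_mat n n" "dagger A = A"
  shows "\<exists>W D. W \<in> carrier_mat n n \<and> D \<in> carrier_mat n n \<and> diagonal_mat D \<and>
    dagger W * W = 1\<^sub>m n \<and> W * dagger W = 1\<^sub>m n \<and> A = W * D * dagger W"
  using assms
proof (induction n arbitrary: A)
  case 0
  then show ?case by (intro exI[of _ "1\<^sub>m 0"] exI[of _ A]) (auto simp: diagonal_mat_def)
next
  case (Suc m)
  let ?n = "Suc m"
  note A = Suc.prems(1)
  obtain v l where v: "(\<Sum>i<?n. v i * cnj (v i)) = 1" "cnj (v 0) = v 0"
    and ev: "\<And>i. i < ?n \<Longrightarrow> (\<Sum>j<?n. A $$ (i, j) * v j) = l * v i"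
    using unit_eigenvector_exists[OF A] by auto
  obtain W where W: "W \<in> carrier_mat ?n ?n" "dagger W = W" "W * W = 1\<^sub>m ?n"
    and Wv: "\<And>i. i < ?n \<Longrightarrow> W $$ (i, 0) = v i"
    using reflection_to_unit_vector[of ?n v] v by auto
  define C where "C = W * (A * W)"
  have AW: "A * W \<in> carrier_mat ?n ?n" using A W by auto
  have C: "C \<in> carrier_mat ?n ?n" using W AW by (auto simp: C_def)
  have Ch: "dagger C = C"
    using A W Suc.prems(2) AW by (simp add: C_def dagger_mult[of _ ?n ?n _ ?n] assoc_mult_mat[of _ ?n ?n _ ?n _ ?n])
  have AC: "A = W * C * W"
  proof -
    have "W * C = (W * W) * (A * W)" unfolding C_def using W(1) AW by (simp add: assoc_mult_mat[of _ ?n ?n _ ?n _ ?n] mult_carrier_square)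
    also have "\<dots> = A * W" unfolding W(3) by (rule left_mult_one_mat[OF AW])
    finally have "W * C * W = A * (W * W)" using A W(1) by (simp add: assoc_mult_mat[of _ ?n ?n _ ?n _ ?n] mult_carrier_square)
    then show ?thesis using A W by simp
  qed
  have C0: "C $$ (i, 0) = (if i = 0 then l else 0)" if i: "i < ?n" for i
  proof -
    have "(A * W) $$ (j, 0) = l * W $$ (j, 0)" if "j < ?n" for j
      using that ev[OF that] by (subst mat_mult_index[OF A W(1)]) (auto simp: Wv)
    then have "C $$ (i, 0) = (\<Sum>j<?n. l * (W $$ (i, j) * W $$ (j, 0)))"
      unfolding C_def using i by (subst mat_mult_index[OF W(1) AW]) (auto intro!: sum.cong)
    also have "\<dots> = l * (W * W) $$ (i, 0)"
      unfolding mat_mult_index[OF W(1) W(1) i zero_less_Suc] sum_distrib_left ..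
    finally show ?thesis using W(3) i by simp
  qed
  have C0': "C $$ (0, i) = (if i = 0 then l else 0)" if i: "i < ?n" for i
  proof -
    have "C $$ (0, i) = cnj (C $$ (i, 0))" using i C by (subst Ch[symmetric]) auto
    then show ?thesis using C0[OF i] by auto
  qed
  define B where "B = mat m m (\<lambda>(i, j). C $$ (Suc i, Suc j))"
  have B: "B \<in> carrier_mat m m" by (simp add: B_def)
  have "dagger B = B"
  proof (rule eq_matI)
    fix i j assume "i < dim_row B" "j < dim_col B"
    then have ij: "i < m" "j < m" using B by auto
    have "cnj (C $$ (Suc j, Suc i)) = C $$ (Suc i, Suc j)"
      using ij C by (subst (2) Ch[symmetric]) auto
    then show "dagger B $$ (i, j) = B $$ (i, j)" using ij by (simp add: B_def)
  qed (use B in auto)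
  then obtain V D where V: "V \<in> carrier_mat m m" "dagger V * V = 1\<^sub>m m" "V * dagger V = 1\<^sub>m m"
    and D: "D \<in> carrier_mat m m" "diagonal_mat D" and BV: "B = V * D * dagger V"
    using Suc.IH[OF B] by auto
  define L where "L = mat 1 1 (\<lambda>_. l)"
  have L: "L \<in> carrier_mat 1 1" by (simp add: L_def)
  let ?blk = "\<lambda>X Y :: complex mat. four_block_mat X (0\<^sub>m 1 m) (0\<^sub>m m 1) Y"
  have blk: "?blk X Y \<in> carrier_mat ?n ?n" if "X \<in> carrier_mat 1 1" "Y \<in> carrier_mat m m" for X Y
    using four_block_carrier_mat[OF that] by simp
  have blkm: "?blk X Y * ?blk X' Y' = ?blk (X * X') (Y * Y')"
    if "X \<in> carrier_mat 1 1" "Y \<in> carrier_mat m m" "X' \<in> carrier_mat 1 1" "Y' \<in> carrier_mat m m" for X Y X' Y'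
    by (subst mult_four_block_mat[of _ 1 1 _ m _ m _ _ 1 _ m]) (use that in auto)
  have blkd: "dagger (?blk X Y) = ?blk (dagger X) (dagger Y)"
    if "X \<in> carrier_mat 1 1" "Y \<in> carrier_mat m m" for X Y
    using that by (intro eq_matI) auto
  define P where "P = ?blk (1\<^sub>m 1) V"
  have P: "P \<in> carrier_mat ?n ?n" unfolding P_def by (intro blk V) auto
  have Pd: "dagger P = ?blk (1\<^sub>m 1) (dagger V)" unfolding P_def using V by (subst blkd) auto
  define E where "E = ?blk L D"
  have E: "E \<in> carrier_mat ?n ?n" unfolding E_def by (intro blk L D)
  have one: "?blk (1\<^sub>m 1) (1\<^sub>m m) = 1\<^sub>m ?n" by (intro eq_matI) auto
  have PP: "dagger P * P = 1\<^sub>m ?n" "P * dagger P = 1\<^sub>m ?n"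
    unfolding Pd unfolding P_def using V by (simp_all add: blkm one plus_1_eq_Suc del: One_nat_def)
  have CE: "C = P * E * dagger P"
  proof -
    have "P * E * dagger P = ?blk L B"
      unfolding Pd unfolding P_def E_def BV using V L D by (simp add: blkm mult_carrier_square del: One_nat_def)
    also have "\<dots> = C"
      using C by (intro eq_matI) (auto simp: L_def B_def C0 C0')
    finally show ?thesis ..
  qed
  have dE: "diagonal_mat E"
    using D L by (auto simp: E_def diagonal_mat_def)
  define U where "U = W * P"
  have U: "U \<in> carrier_mat ?n ?n" using W P by (auto simp: U_def)
  have Ud: "dagger U = dagger P * W" unfolding U_def using W P by (simp add: dagger_mult[of _ ?n ?n _ ?n])
  note assoc = assoc_mult_mat[of _ ?n ?n _ ?n _ ?n]
  have dP: "dagger P \<in> carrier_mat ?n ?n" using P by simp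
  have "dagger U * U = dagger P * ((W * W) * P)"
    unfolding Ud unfolding U_def using W(1) P dP by (simp add: assoc mult_carrier_square)
  then have u1: "dagger U * U = 1\<^sub>m ?n" using W P PP by simp
  have "U * dagger U = W * ((P * dagger P) * W)"
    unfolding Ud unfolding U_def using W(1) P dP by (simp add: assoc mult_carrier_square)
  then have u2: "U * dagger U = 1\<^sub>m ?n" using W P PP by simp
  have "A = U * E * dagger U"
    unfolding AC unfolding CE unfolding Ud unfolding U_def using W(1) P dP E by (simp add: assoc mult_carrier_square)
  with U E dE u1 u2 show ?case by blast
qed

text \<open>The diagonal of a Hermitian matrix is the image of its spectrum under the doubly
  stochastic matrix of the squared moduli of the entries of \<open>W\<close>, and \<open>eta\<close>
  is concave.\<close>

lemma vn_entropy_gram_le: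
  assumes G: "G \<in> carrier_mat n m"
  shows "vn_entropy (G * dagger G) \<le> (\<Sum>i<n. eta (\<Sum>k<m. (cmod (G $$ (i, k)))^2))"
proof -
  define A where "A = G * dagger G"
  have A: "A \<in> carrier_mat n n" using G by (auto simp: A_def)
  have "dagger A = A" unfolding A_def by (rule dagger_gram[OF G])
  then obtain W D where W: "W \<in> carrier_mat n n" "dagger W * W = 1\<^sub>m n" "W * dagger W = 1\<^sub>m n"
    and D: "D \<in> carrier_mat n n" "diagonal_mat D" and AW: "A = W * D * dagger W"
    using hermitian_spectral[OF A] by blast
  note assoc = assoc_mult_mat[of _ n n _ n _ n]
  have dW: "dagger W \<in> carrier_mat n n" using W by simp
  have "similar_mat_wit A D W (dagger W)"
    using A D(1) W dW AW by (intro similar_mat_witI[of _ _ n])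
  then have "char_poly A = char_poly D"
    by (intro char_poly_similar) (auto simp: similar_mat_def)
  also have "\<dots> = (\<Prod>a\<leftarrow>diag_mat D. [:- a, 1:])"
    using D by (intro char_poly_upper_triangular[of _ n]) (auto simp: diagonal_mat_def upper_triangular_def)
  finally have "vn_entropy A = (\<Sum>a\<leftarrow>diag_mat D. eta (Re a))"
    by (simp only: vn_entropy_root_entropy root_entropy_prod_list)
  also have "\<dots> = (\<Sum>j<n. eta (Re (D $$ (j, j))))"
    using D by (simp add: diag_mat_def interv_sum_list_conv_sum_set_nat atLeast0LessThan o_def)
  finally have vnA: "vn_entropy A = (\<Sum>j<n. eta (Re (D $$ (j, j))))" .
  \<comment> \<open>The Gram form shows that the eigenvalues are real and nonnegative: they are
    squared row norms of \<open>dagger W * G\<close>.\<close>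
  define d where "d j = (\<Sum>k<m. (cmod ((dagger W * G) $$ (j, k)))^2)" for j
  have DG: "D = (dagger W * G) * dagger (dagger W * G)"
  proof -
    have "dagger W * A * W = (dagger W * W) * D * (dagger W * W)"
      unfolding AW using W(1) D(1) dW by (simp add: assoc mult_carrier_square)
    then have "D = dagger W * A * W" using W D by simp
    also have "\<dots> = (dagger W * G) * (dagger G * W)"
    proof -
      have dG: "dagger G \<in> carrier_mat m n" using G by simp
      have "dagger W * A * W = dagger W * (A * W)" by (rule assoc_mult_mat[OF dW A W(1)])
      also have "A * W = G * (dagger G * W)" unfolding A_def by (rule assoc_mult_mat[OF G dG W(1)])
      also have "dagger W * (G * (dagger G * W)) = (dagger W * G) * (dagger G * W)"
        using assoc_mult_mat[OF dW G, of "dagger G * W" n] dG W(1) by simp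
      finally show ?thesis .
    qed
    finally show ?thesis using W G by (simp add: dagger_mult[of _ n n _ m])
  qed
  have Djj: "D $$ (j, j) = complex_of_real (d j)" if j: "j < n" for j
  proof -
    have "dagger W * G \<in> carrier_mat n m" using dW G by auto
    from gram_index[OF this j j] show ?thesis
      unfolding DG[symmetric] d_def by (simp only: complex_norm_square of_real_sum)
  qed
  have d0: "0 \<le> d j" for j by (auto simp: d_def intro: sum_nonneg)
  define w where "w i j = (cmod (W $$ (i, j)))^2" for i j
  have row: "(\<Sum>j<n. w i j) = 1" if i: "i < n" for i
  proof -
    have "complex_of_real (\<Sum>j<n. w i j) = (W * dagger W) $$ (i, i)"
      unfolding gram_index[OF W(1) i i] w_def by (simp only: complex_norm_square of_real_sum)
    then show ?thesis using W i by (simp del: of_real_sum)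
  qed
  have column: "(\<Sum>i<n. w i j) = 1" if j: "j < n" for j
  proof -
    have "complex_of_real (\<Sum>i<n. w i j) = (dagger W * W) $$ (j, j)"
      unfolding mat_mult_index[OF dW W(1) j j] w_def of_real_sum complex_norm_square
      using W j by (intro sum.cong) auto
    then show ?thesis using W j by (simp del: of_real_sum)
  qed
  have Aii: "(\<Sum>k<m. (cmod (G $$ (i, k)))^2) = (\<Sum>j<n. w i j * d j)" if i: "i < n" for i
  proof -
    have WD: "(W * D) $$ (i, j) = W $$ (i, j) * d j" if "j < n" for j
    proof -
      have "(W * D) $$ (i, j) = (\<Sum>k<n. W $$ (i, k) * D $$ (k, j))"
        by (rule mat_mult_index[OF W(1) D(1) i that])
      also have "\<dots> = (\<Sum>k<n. if k = j then W $$ (i, k) * d j else 0)"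
        using D that by (intro sum.cong) (auto simp: diagonal_mat_def Djj)
      finally show ?thesis using that by simp
    qed
    have "complex_of_real (\<Sum>k<m. (cmod (G $$ (i, k)))^2) = A $$ (i, i)"
      unfolding A_def gram_index[OF G i i] by (simp only: complex_norm_square of_real_sum)
    also have "\<dots> = (\<Sum>j<n. (W * D) $$ (i, j) * dagger W $$ (j, i))"
      unfolding AW using W D dW i by (subst mat_mult_index[of _ n n _ n]) auto
    also have "\<dots> = (\<Sum>j<n. complex_of_real (w i j * d j))"
      unfolding w_def of_real_mult complex_norm_square using W i by (intro sum.cong) (auto simp: WD)
    finally show ?thesis by (simp only: of_real_sum[symmetric] of_real_eq_iff)
  qed
  have "vn_entropy A = (\<Sum>j<n. (\<Sum>i<n. w i j) * eta (d j))"
    unfolding vnA by (intro sum.cong) (auto simp: Djj column)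
  also have "\<dots> = (\<Sum>i<n. \<Sum>j<n. w i j * eta (d j))"
    unfolding sum_distrib_right by (rule sum.swap)
  also have "\<dots> \<le> (\<Sum>i<n. eta (\<Sum>j<n. w i j * d j))"
  proof (rule sum_mono)
    fix i assume i: "i \<in> {..<n}"
    have w0: "0 \<le> w i j" for j by (simp add: w_def)
    have "(\<Sum>j<n. w i j * nent (d j)) / ln 2 \<le> nent (\<Sum>j<n. w i j * d j) / ln 2"
      using row i w0 d0 by (intro divide_right_mono nent_jensen) auto
    moreover have "0 \<le> (\<Sum>j<n. w i j * d j)" using w0 d0 by (intro sum_nonneg) auto
    ultimately show "(\<Sum>j<n. w i j * eta (d j)) \<le> eta (\<Sum>j<n. w i j * d j)"
      using d0 by (simp add: eta_eq_nent sum_divide_distrib)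
  qed
  also have "\<dots> = (\<Sum>i<n. eta (\<Sum>k<m. (cmod (G $$ (i, k)))^2))"
    by (intro sum.cong) (auto simp: Aii)
  finally show ?thesis unfolding A_def .
qed

text \<open>\<open>X * dagger X\<close> and \<open>dagger X * X\<close> have the same entropy, so
  \<open>X\<close> may be exchanged for any rows \<open>z\<close> with the same
  \<open>dagger X * X\<close>, whatever their number. Later four rows replace an ancilla of
  arbitrary dimension.\<close>

lemma vn_entropy_le_of_equal_gram:
  fixes z :: "nat \<Rightarrow> nat \<Rightarrow> complex"
  assumes X: "X \<in> carrier_mat n m"
    and eq: "\<And>k l. k < m \<Longrightarrow> l < m \<Longrightarrow>
      (\<Sum>i<n. cnj (X $$ (i, k)) * X $$ (i, l)) = (\<Sum>i<M. cnj (z i k) * z i l)"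
  shows "vn_entropy (X * dagger X) \<le> (\<Sum>i<M. eta (\<Sum>k<m. (cmod (z i k))^2))"
proof -
  define Z where "Z = mat M m (\<lambda>(i, k). z i k)"
  have Z: "Z \<in> carrier_mat M m" by (simp add: Z_def)
  have "dagger X * X = dagger Z * Z"
  proof (rule eq_matI)
    fix k l assume "k < dim_row (dagger Z * Z)" "l < dim_col (dagger Z * Z)"
    then have kl: "k < m" "l < m" using Z by auto
    show "(dagger X * X) $$ (k, l) = (dagger Z * Z) $$ (k, l)"
      unfolding mat_mult_index[OF dagger_carrier[OF X] X kl] mat_mult_index[OF dagger_carrier[OF Z] Z kl]
      using eq[OF kl] X kl by (simp add: Z_def)
  qed (use X Z in auto)
  then have "vn_entropy (X * dagger X) = vn_entropy (Z * dagger Z)"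
    using vn_entropy_mult_commute[OF X dagger_carrier[OF X]]
      vn_entropy_mult_commute[OF Z dagger_carrier[OF Z]] by simp
  also have "\<dots> \<le> (\<Sum>i<M. eta (\<Sum>k<m. (cmod (Z $$ (i, k)))^2))"
    by (rule vn_entropy_gram_le[OF Z])
  finally show ?thesis by (simp add: Z_def)
qed

section \<open>Finite sums over pairs of indices\<close>

lemma sum_lessThan_2: "(\<Sum>i<2. h i) = h 0 + h (1::nat)"
  by (simp add: numeral_2_eq_2)

lemma sum_lessThan_4: "(\<Sum>i<4. h i) = h 0 + h 1 + h 2 + h (3::nat)"
  for h :: "nat \<Rightarrow> 'a :: comm_monoid_add"
  by (simp add: numeral_eq_Suc add_ac)

lemma sum_div_mod:
  fixes h :: "nat \<Rightarrow> nat \<Rightarrow> 'a :: comm_monoid_add"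
  assumes "0 < d"
  shows "(\<Sum>k<n * d. h (k div d) (k mod d)) = (\<Sum>a<n. \<Sum>r<d. h a r)"
proof -
  have "(\<Sum>k<n * d. h (k div d) (k mod d)) = (\<Sum>a<n. \<Sum>k = a * d..<a * d + d. h (k div d) (k mod d))"
    by (simp add: sum.nat_group)
  also have "\<dots> = (\<Sum>a<n. \<Sum>r<d. h a r)"
  proof (rule sum.cong[OF refl])
    fix a
    have "(\<Sum>k = a * d..<a * d + d. h (k div d) (k mod d))
      = (\<Sum>r = 0..<d. h ((r + a * d) div d) ((r + a * d) mod d))"
      using sum.shift_bounds_nat_ivl[of "\<lambda>k. h (k div d) (k mod d)" 0 "a * d" d] by (simp add: add.commute)
    also have "\<dots> = (\<Sum>r<d. h a r)" using assms by (intro sum.cong) auto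
    finally show "(\<Sum>k = a * d..<a * d + d. h (k div d) (k mod d)) = (\<Sum>r<d. h a r)" .
  qed
  finally show ?thesis .
qed

section \<open>The partial swap gate\<close>

text \<open>For nonzero \<open>b\<close> this is a quadratic equation in the ratio of
  \<open>y\<close> to \<open>x\<close>, solvable over the complex numbers; scaling then normalizes
  the pair.\<close>

lemma rotation_parameters:
  fixes a b c d :: complex
  shows "\<exists>x y. x * cnj x + y * cnj y = 1 \<and> x^2 * c - y^2 * b - x * y * (a - d) = 0"
proof (cases "b = 0")
  case True
  then show ?thesis by (intro exI[of _ 0] exI[of _ 1]) simp
next
  case False
  obtain t where t: "poly [:- c, a - d, b:] t = 0"
    using fundamental_theorem_of_algebra[of "[:- c, a - d, b:]"] False by (auto simp: constant_degree)
  define R where "R = 1 + (cmod t)^2"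
  have R: "0 < R" by (simp add: R_def add_pos_nonneg)
  define x where "x = complex_of_real (1 / sqrt R)"
  have xx: "x * cnj x = 1 / R" using R by (simp add: x_def flip: of_real_mult)
  have "x * cnj x + (t * x) * cnj (t * x) = (x * cnj x) * (1 + t * cnj t)" by (simp add: algebra_simps)
  also have "1 + t * cnj t = R" unfolding R_def of_real_add complex_norm_square by simp
  finally have "x * cnj x + (t * x) * cnj (t * x) = 1" unfolding xx using R by simp
  moreover have "x^2 * c - (t * x)^2 * b - x * (t * x) * (a - d) = - (x^2 * poly [:- c, a - d, b:] t)"
    by (simp add: power2_eq_square algebra_simps)
  ultimately show ?thesis using t by (intro exI[of _ x] exI[of _ "t * x"]) simp
qed

text \<open>Diagonalizes the 2 by 2 Gram matrix of \<open>g\<close> and \<open>h\<close> by a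
  unitary. It is applied once to the input on B and once inside a charge sector of the
  output.\<close>

lemma orthogonalizing_rotation:
  fixes g h :: "'i \<Rightarrow> complex"
  shows "\<exists>x y. x * cnj x + y * cnj y = 1 \<and>
    (\<Sum>k\<in>K. (cnj x * g k + cnj y * h k) * cnj (- y * g k + x * h k)) = 0"
proof -
  let ?i = "\<lambda>u v. \<Sum>k\<in>K. u k * cnj (v k)"
  obtain x y where xy: "x * cnj x + y * cnj y = 1"
    "x^2 * cnj (?i g h) - y^2 * cnj (?i h g) - x * y * cnj (?i g g - ?i h h) = 0"
    using rotation_parameters[of "cnj (?i g h)" "cnj (?i h g)" "cnj (?i g g)" "cnj (?i h h)"]
    unfolding complex_cnj_diff by blast
  have "(\<Sum>k\<in>K. (cnj x * g k + cnj y * h k) * cnj (- y * g k + x * h k)) =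
    (\<Sum>k\<in>K. (cnj x)^2 * (g k * cnj (h k)) - (cnj y)^2 * (h k * cnj (g k))
      - cnj x * cnj y * (g k * cnj (g k)) + cnj x * cnj y * (h k * cnj (h k)))"
    by (intro sum.cong) (auto simp: power2_eq_square algebra_simps)
  also have "\<dots> = (cnj x)^2 * ?i g h - (cnj y)^2 * ?i h g - cnj x * cnj y * ?i g g + cnj x * cnj y * ?i h h"
    by (simp only: sum.distrib sum_subtractf sum_distrib_left)
  also have "\<dots> = cnj (x^2 * cnj (?i g h) - y^2 * cnj (?i h g) - x * y * cnj (?i g g - ?i h h))"
    by (simp only: complex_cnj_diff complex_cnj_mult complex_cnj_power complex_cnj_cnj) (simp add: algebra_simps)
  also have "\<dots> = 0" unfolding xy(2) by simp
  finally show ?thesis using xy(1) by blast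
qed

lemma rotation_isometry:
  assumes "x * cnj x + y * cnj y = 1"
  shows "(x * A - cnj y * B) * cnj (x * C - cnj y * D) + (y * A + cnj x * B) * cnj (y * C + cnj x * D)
    = A * cnj C + B * cnj D"
proof -
  have "(x * A - cnj y * B) * cnj (x * C - cnj y * D) + (y * A + cnj x * B) * cnj (y * C + cnj x * D)
    = (x * cnj x + y * cnj y) * (A * cnj C + B * cnj D)"
    by (simp add: algebra_simps)
  then show ?thesis using assms by simp
qed

text \<open>The sum of the three products of Pauli matrices is twice the swap minus the identity. So
  \<open>K0 - K1\<close> is the coefficient of the identity and \<open>2 * K1\<close> that of the
  swap.\<close>

lemma Ugate_index:
  assumes "a < 2" "b < 2" "a' < 2" "b' < 2"
  shows "Ugate x $$ (2 * a + b, 2 * a' + b') = exp (- \<i> * complex_of_real x) *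
    (complex_of_real (cos (2 * x)) * (if a = a' \<and> b = b' then 1 else 0)
     + \<i> * complex_of_real (sin (2 * x)) * (if a = b' \<and> b = a' then 1 else 0))"
proof -
  define K0 where "K0 = complex_of_real ((cos x)^3) + \<i> * complex_of_real ((sin x)^3)"
  define K1 where "K1 = \<i> * complex_of_real (sin x * cos x) * exp (- \<i> * complex_of_real x)"
  have e: "exp (- \<i> * complex_of_real x) = Complex (cos x) (- sin x)"
    by (simp add: exp_eq_polar complex_eq_iff)
  have d: "K0 - K1 = exp (- \<i> * complex_of_real x) * complex_of_real (cos (2 * x))"
    unfolding K0_def K1_def e cos_double
    by (simp add: complex_eq_iff power2_eq_square power3_eq_cube algebra_simps)
  have s: "2 * K1 = exp (- \<i> * complex_of_real x) * (\<i> * complex_of_real (sin (2 * x)))"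
    unfolding K1_def sin_double by simp
  have a: "K0 + K1 = exp (- \<i> * complex_of_real x) * (complex_of_real (cos (2 * x)) + \<i> * complex_of_real (sin (2 * x)))"
    using d s by (simp add: algebra_simps)
  note K01 = d s a
  have cases: "a = 0 \<or> a = 1" "b = 0 \<or> b = 1" "a' = 0 \<or> a' = 1" "b' = 0 \<or> b' = 1"
    using assms by auto
  then have "Ugate x $$ (2 * a + b, 2 * a' + b') =
    (if a = a' \<and> b = b' then (if a = b then K0 + K1 else K0 - K1)
     else if a = b' \<and> b = a' then 2 * K1 else 0)"
    unfolding Ugate_def K0_def[symmetric] K1_def[symmetric]
    by (elim disjE) (simp_all add: kron2_def pauli_def mat_of_rows_list_def)
  with cases show ?thesis
    unfolding K01 by (elim disjE) simp_all
qed

lemma phase_cnj: "exp (- \<i> * complex_of_real x) * cnj (exp (- \<i> * complex_of_real x)) = 1"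
proof -
  have "exp (- \<i> * complex_of_real x) = Complex (cos x) (- sin x)"
    by (simp add: exp_eq_polar complex_eq_iff)
  then show ?thesis by (simp add: complex_eq_iff)
qed

lemma out_amp_Ugate:
  assumes "a < 2" "b < 2"
  shows "out_amp (Ugate x) dA dB phi psi a r b s = exp (- \<i> * complex_of_real x) *
    (complex_of_real (cos (2 * x)) * phi $ (a * dA + r) * psi $ (b * dB + s)
     + \<i> * complex_of_real (sin (2 * x)) * phi $ (b * dA + r) * psi $ (a * dB + s))"
proof -
  have "out_amp (Ugate x) dA dB phi psi a r b s = (\<Sum>a'<2. \<Sum>b'<2. exp (- \<i> * complex_of_real x) *
    (complex_of_real (cos (2 * x)) * (if a = a' \<and> b = b' then 1 else 0)
     + \<i> * complex_of_real (sin (2 * x)) * (if a = b' \<and> b = a' then 1 else 0))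
     * phi $ (a' * dA + r) * psi $ (b' * dB + s))"
    unfolding out_amp_def using assms by (intro sum.cong) (auto simp: Ugate_index)
  also have "\<dots> = exp (- \<i> * complex_of_real x) *
    (complex_of_real (cos (2 * x)) * phi $ (a * dA + r) * psi $ (b * dB + s)
     + \<i> * complex_of_real (sin (2 * x)) * phi $ (b * dA + r) * psi $ (a * dB + s))"
    using assms by (auto simp: less_2_cases_iff sum_lessThan_2 algebra_simps)
  finally show ?thesis .
qed

text \<open>Trace and determinant of a Gram matrix are unitary invariants. They give the sum and
  product of two eigenvalues without solving for them.\<close>

lemma rotation_gram:
  fixes g h :: "'i \<Rightarrow> complex" and K :: "'i set"
  defines "ip \<equiv> \<lambda>u v. \<Sum>k\<in>K. u k * cnj (v k)"
  assumes xy: "x * cnj x + y * cnj y = 1"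
  defines "u \<equiv> \<lambda>k. cnj x * g k + cnj y * h k" and "v \<equiv> \<lambda>k. - y * g k + x * h k"
  shows "ip u u + ip v v = ip g g + ip h h"
    and "ip u u * ip v v - ip u v * ip v u = ip g g * ip h h - ip g h * ip h g"
proof -
  have lin: "ip (\<lambda>k. a * g k + b * h k) (\<lambda>k. c * g k + d * h k) =
    a * cnj c * ip g g + a * cnj d * ip g h + b * cnj c * ip h g + b * cnj d * ip h h" for a b c d
  proof -
    have "ip (\<lambda>k. a * g k + b * h k) (\<lambda>k. c * g k + d * h k) =
      (\<Sum>k\<in>K. a * cnj c * (g k * cnj (g k)) + a * cnj d * (g k * cnj (h k))
        + b * cnj c * (h k * cnj (g k)) + b * cnj d * (h k * cnj (h k)))"
      unfolding ip_def by (intro sum.cong) (auto simp: algebra_simps)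
    then show ?thesis unfolding ip_def by (simp only: sum.distrib sum_distrib_left)
  qed
  have "ip u u + ip v v = (x * cnj x + y * cnj y) * (ip g g + ip h h)"
    unfolding u_def v_def lin by (simp add: algebra_simps)
  then show "ip u u + ip v v = ip g g + ip h h" by (simp add: xy)
  have "ip u u * ip v v - ip u v * ip v u =
    (x * cnj x + y * cnj y)^2 * (ip g g * ip h h - ip g h * ip h g)"
    unfolding u_def v_def lin by (simp add: algebra_simps power2_eq_square)
  then show "ip u u * ip v v - ip u v * ip v u = ip g g * ip h h - ip g h * ip h g" by (simp add: xy)
qed

section \<open>Bipartite states and the upper bound for all inputs\<close>

lemma sum_norm_sq_complex:
  "complex_of_real (\<Sum>k\<in>K. (cmod (f k))^2) = (\<Sum>k\<in>K. f k * cnj (f k))"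
  by (simp only: complex_norm_square of_real_sum)

lemma bipartite_norm:
  assumes "unit_state (2 * d) v" "0 < d"
  shows "(\<Sum>r<d. v $ r * cnj (v $ r)) + (\<Sum>r<d. v $ (d + r) * cnj (v $ (d + r))) = 1"
proof -
  have "1 = complex_of_real (\<Sum>k<2 * d. (cmod (v $ k))^2)"
    using assms by (simp add: unit_state_def)
  also have "\<dots> = (\<Sum>k<2 * d. v $ (k div d * d + k mod d) * cnj (v $ (k div d * d + k mod d)))"
    unfolding sum_norm_sq_complex by simp
  also have "\<dots> = (\<Sum>a<2. \<Sum>r<d. v $ (a * d + r) * cnj (v $ (a * d + r)))"
    by (rule sum_div_mod[OF assms(2), where h = "\<lambda>a r. v $ (a * d + r) * cnj (v $ (a * d + r))"])
  finally show ?thesis by (simp add: sum_lessThan_2)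
qed

text \<open>Reshaping the output state this way turns the partial trace into a Gram matrix.\<close>

definition output_matrix where
  "output_matrix U dA dB phi psi = mat (2 * dB) (2 * dA)
    (\<lambda>(i, k). out_amp U dA dB phi psi (k div dA) (k mod dA) (i div dB) (i mod dB))"

lemma reduced_BR_eq_gram:
  assumes "0 < dA"
  shows "reduced_BR U dA dB phi psi = output_matrix U dA dB phi psi * dagger (output_matrix U dA dB phi psi)"
proof (rule eq_matI)
  let ?X = "output_matrix U dA dB phi psi"
  have X: "?X \<in> carrier_mat (2 * dB) (2 * dA)" by (simp add: output_matrix_def)
  fix i j assume "i < dim_row (?X * dagger ?X)" "j < dim_col (?X * dagger ?X)"
  then have ij: "i < 2 * dB" "j < 2 * dB" using X by auto
  have "(?X * dagger ?X) $$ (i, j) = (\<Sum>k<2 * dA. ?X $$ (i, k) * cnj (?X $$ (j, k)))"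
    by (rule gram_index[OF X ij])
  also have "\<dots> = (\<Sum>k<2 * dA. out_amp U dA dB phi psi (k div dA) (k mod dA) (i div dB) (i mod dB)
    * cnj (out_amp U dA dB phi psi (k div dA) (k mod dA) (j div dB) (j mod dB)))"
    using ij by (intro sum.cong) (auto simp: output_matrix_def)
  also have "\<dots> = (\<Sum>a<2. \<Sum>r<dA. out_amp U dA dB phi psi a r (i div dB) (i mod dB)
    * cnj (out_amp U dA dB phi psi a r (j div dB) (j mod dB)))"
    by (rule sum_div_mod[OF assms, where h = "\<lambda>a r. out_amp U dA dB phi psi a r (i div dB) (i mod dB)
    * cnj (out_amp U dA dB phi psi a r (j div dB) (j mod dB))"])
  finally show "reduced_BR U dA dB phi psi $$ (i, j) = (?X * dagger ?X) $$ (i, j)"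
    using ij by (simp add: reduced_BR_def)
qed (auto simp: reduced_BR_def output_matrix_def)

lemma ent_out_Ugate_le:
  fixes x :: real
  defines "a \<equiv> (sin (2 * x))^2 / 4"
  assumes d: "1 \<le> dA" "1 \<le> dB" and phi: "unit_state (2 * dA) phi" and psi: "unit_state (2 * dB) psi"
    and s0: "sin (2 * x) \<noteq> 0"
  shows "ent_out (Ugate x) dA dB phi psi
    \<le> max (nent (4 * a) + nent (1 - 4 * a)) (3 * nent a + nent (1 - 3 * a)) / ln 2"
proof -
  have d0: "0 < dA" "0 < dB" using d by auto
  define C S where "C = cos (2 * x)" and "S = sin (2 * x)"
  have CS: "C^2 = 1 - S^2" unfolding C_def S_def by (simp add: cos_squared_eq)
  define c s where "c = complex_of_real C" and "s = complex_of_real S"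
  have cs: "c * c + s * s = 1"
    using CS unfolding c_def s_def by (simp add: power2_eq_square flip: of_real_mult of_real_add)
  have cnjs: "cnj c = c" "cnj s = s" by (simp_all add: c_def s_def)
  define \<omega> where "\<omega> = exp (- \<i> * complex_of_real x)"
  have \<omega>: "cnj \<omega> * \<omega> = 1"
    unfolding \<omega>_def by (subst mult.commute) (rule phase_cnj)

  obtain t y where ty: "t * cnj t + y * cnj y = 1"
    and orth: "(\<Sum>k<dB. (cnj t * psi $ k + cnj y * psi $ (dB + k)) * cnj (- y * psi $ k + t * psi $ (dB + k))) = 0"
    using orthogonalizing_rotation[of "\<lambda>k. psi $ k" "\<lambda>k. psi $ (dB + k)" "{..<dB}"] by blast
  \<comment> \<open>The columns of a unitary \<open>V\<close>, with \<open>F0\<close>,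
    \<open>F1\<close>, \<open>G0\<close>, \<open>G1\<close> the components of the inputs along them.
    The same \<open>V\<close> serves A and B because the gate commutes with
    \<open>V \<otimes> V\<close>.\<close>
  define V0 V1 where "V0 b = (if b = 0 then t else y)" and "V1 b = (if b = 0 then - cnj y else cnj t)" for b :: nat
  have iso: "(\<Sum>b<2. (V0 b * A + V1 b * B) * cnj (V0 b * A' + V1 b * B')) = A * cnj A' + B * cnj B'" for A B A' B'
    using rotation_isometry[OF ty, of A B A' B'] by (simp add: sum_lessThan_2 V0_def V1_def)
  define F0 F1 where "F0 r = cnj t * phi $ r + cnj y * phi $ (dA + r)"
    and "F1 r = - y * phi $ r + t * phi $ (dA + r)" for r
  define G0 G1 where "G0 r = cnj t * psi $ r + cnj y * psi $ (dB + r)"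
    and "G1 r = - y * psi $ r + t * psi $ (dB + r)" for r
  have inv: "v = t * (cnj t * v + cnj y * w) - cnj y * (- y * v + t * w)"
    "w = y * (cnj t * v + cnj y * w) + cnj t * (- y * v + t * w)" for v w
  proof -
    have "t * (cnj t * v + cnj y * w) - cnj y * (- y * v + t * w) = (t * cnj t + y * cnj y) * v"
      "y * (cnj t * v + cnj y * w) + cnj t * (- y * v + t * w) = (t * cnj t + y * cnj y) * w"
      by (simp_all add: algebra_simps)
    then show "v = t * (cnj t * v + cnj y * w) - cnj y * (- y * v + t * w)"
      "w = y * (cnj t * v + cnj y * w) + cnj t * (- y * v + t * w)" by (simp_all add: ty)
  qed
  have phi_eq: "phi $ (b * dA + r) = V0 b * F0 r + V1 b * F1 r" if "b < 2" for b r
    using that inv(1)[of "phi $ r" "phi $ (dA + r)"] inv(2)[of "phi $ (dA + r)" "phi $ r"]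
    by (auto simp: less_2_cases_iff V0_def V1_def F0_def F1_def)
  have psi_eq: "psi $ (b * dB + r) = V0 b * G0 r + V1 b * G1 r" if "b < 2" for b r
    using that inv(1)[of "psi $ r" "psi $ (dB + r)"] inv(2)[of "psi $ (dB + r)" "psi $ r"]
    by (auto simp: less_2_cases_iff V0_def V1_def G0_def G1_def)

  define p0 p1 where "p0 = (\<Sum>r<dA. (cmod (F0 r))^2)" and "p1 = (\<Sum>r<dA. (cmod (F1 r))^2)"
  define q0 q1 where "q0 = (\<Sum>r<dB. (cmod (G0 r))^2)" and "q1 = (\<Sum>r<dB. (cmod (G1 r))^2)"
  have pc: "(\<Sum>r<dA. F0 r * cnj (F0 r)) = complex_of_real p0" "(\<Sum>r<dA. F1 r * cnj (F1 r)) = complex_of_real p1"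
    unfolding p0_def p1_def sum_norm_sq_complex by auto
  have qc: "(\<Sum>r<dB. G0 r * cnj (G0 r)) = complex_of_real q0" "(\<Sum>r<dB. G1 r * cnj (G1 r)) = complex_of_real q1"
    unfolding q0_def q1_def sum_norm_sq_complex by auto
  have nn: "0 \<le> p0" "0 \<le> p1" "0 \<le> q0" "0 \<le> q1"
    by (auto simp: p0_def p1_def q0_def q1_def intro: sum_nonneg)
  have "complex_of_real (p0 + p1) = 1"
    using rotation_gram(1)[OF ty, where K = "{..<dA}" and g = "\<lambda>k. phi $ k" and h = "\<lambda>k. phi $ (dA + k)"]
      bipartite_norm[OF phi d0(1)]
    by (simp only: of_real_add pc[symmetric] F0_def F1_def)
  then have p: "p1 = 1 - p0" by (simp only: of_real_eq_1_iff)
  have "complex_of_real (q0 + q1) = 1"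
    using rotation_gram(1)[OF ty, where K = "{..<dB}" and g = "\<lambda>k. psi $ k" and h = "\<lambda>k. psi $ (dB + k)"]
      bipartite_norm[OF psi d0(2)]
    by (simp only: of_real_add qc[symmetric] G0_def G1_def)
  then have q: "q1 = 1 - q0" by (simp only: of_real_eq_1_iff)
  have G01: "(\<Sum>r<dB. G0 r * cnj (G1 r)) = 0" using orth by (simp only: G0_def G1_def)
  have "cnj (\<Sum>r<dB. G0 r * cnj (G1 r)) = (\<Sum>r<dB. G1 r * cnj (G0 r))" by (simp add: mult.commute)
  then have G10: "(\<Sum>r<dB. G1 r * cnj (G0 r)) = 0" unfolding G01 by simp

  \<comment> \<open>The first index is the level of B after the gate, the second its level before.
    So \<open>z01\<close> and \<open>z10\<close> stem from the swap alone.\<close>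
  define z00 where "z00 b r = V0 b * ((c + \<i> * s) * F0 r) + V1 b * (c * F1 r)" for b r
  define z11 where "z11 b r = V0 b * (c * F0 r) + V1 b * ((c + \<i> * s) * F1 r)" for b r
  define z01 where "z01 b r = V0 b * 0 + V1 b * (\<i> * s * F0 r)" for b r
  define z10 where "z10 b r = V0 b * (\<i> * s * F1 r) + V1 b * 0" for b r
  have amp: "out_amp (Ugate x) dA dB phi psi e r b k =
    \<omega> * (V0 b * (G0 k * z00 e r + G1 k * z01 e r) + V1 b * (G0 k * z10 e r + G1 k * z11 e r))"
    if "e < 2" "b < 2" for e r b k
    unfolding out_amp_Ugate[OF that] C_def[symmetric] S_def[symmetric] c_def[symmetric] s_def[symmetric]
      \<omega>_def[symmetric] phi_eq[OF that(1)] phi_eq[OF that(2)] psi_eq[OF that(1)] psi_eq[OF that(2)]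
      z00_def z01_def z10_def z11_def
    by (simp add: algebra_simps)

  define flat where "flat f k = f (k div dA) (k mod dA)" for f :: "nat \<Rightarrow> nat \<Rightarrow> complex" and k
  have sq: "complex_of_real (sqrt q0) * complex_of_real (sqrt q0) = q0"
    "complex_of_real (sqrt q1) * complex_of_real (sqrt q1) = q1"
    using nn by (simp_all flip: of_real_mult)
  \<comment> \<open>These two vectors share a charge, so their coherence is kept: they are rotated
    to orthogonal \<open>w0\<close> and \<open>w1\<close>, whose squared norms \<open>l\<close> and
    \<open>m\<close> are the eigenvalues of that block. The other two sectors contribute one row
    each.\<close>
  define Z00 Z11 where "Z00 k = complex_of_real (sqrt q0) * flat z00 k"
    and "Z11 k = complex_of_real (sqrt q1) * flat z11 k" for k
  define ip where "ip u v = (\<Sum>k<2 * dA. u k * cnj (v k))" for u v :: "nat \<Rightarrow> complex"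
  obtain t' y' where ty': "t' * cnj t' + y' * cnj y' = 1"
    and orth': "(\<Sum>k<2 * dA. (cnj t' * Z00 k + cnj y' * Z11 k) * cnj (- y' * Z00 k + t' * Z11 k)) = 0"
    using orthogonalizing_rotation[of Z00 Z11 "{..<2 * dA}"] by blast
  define w0 w1 where "w0 k = cnj t' * Z00 k + cnj y' * Z11 k" and "w1 k = - y' * Z00 k + t' * Z11 k" for k
  define l m where "l = (\<Sum>k<2 * dA. (cmod (w0 k))^2)" and "m = (\<Sum>k<2 * dA. (cmod (w1 k))^2)"
  define z where "z i = (if i = 0 then w0 else if i = 1 then w1
    else if i = 2 then (\<lambda>k. complex_of_real (sqrt q1) * flat z01 k)
    else (\<lambda>k. complex_of_real (sqrt q0) * flat z10 k))" for i :: nat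

  have ipz: "ip (flat (\<lambda>b r. V0 b * A r + V1 b * B r)) (flat (\<lambda>b r. V0 b * A' r + V1 b * B' r))
    = (\<Sum>r<dA. A r * cnj (A' r)) + (\<Sum>r<dA. B r * cnj (B' r))" for A B A' B'
  proof -
    have "ip (flat (\<lambda>b r. V0 b * A r + V1 b * B r)) (flat (\<lambda>b r. V0 b * A' r + V1 b * B' r))
      = (\<Sum>b<2. \<Sum>r<dA. (V0 b * A r + V1 b * B r) * cnj (V0 b * A' r + V1 b * B' r))"
      unfolding ip_def flat_def
      by (rule sum_div_mod[OF d0(1), where h = "\<lambda>b r. (V0 b * A r + V1 b * B r) * cnj (V0 b * A' r + V1 b * B' r)"])
    also have "\<dots> = (\<Sum>r<dA. \<Sum>b<2. (V0 b * A r + V1 b * B r) * cnj (V0 b * A' r + V1 b * B' r))"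
      by (rule sum.swap)
    finally show ?thesis unfolding iso sum.distrib .
  qed
  have scal: "(\<Sum>r<dA. (A * F r) * cnj (B * G r)) = A * cnj B * (\<Sum>r<dA. F r * cnj (G r))" for A B F G
    unfolding sum_distrib_left by (intro sum.cong) auto
  have ips: "ip (\<lambda>k. A * F k) (\<lambda>k. B * G k) = A * cnj B * ip F G" for A B F G
    unfolding ip_def sum_distrib_left by (intro sum.cong) auto
  \<comment> \<open>Zeros are written as \<open>0 * F0 r\<close> and \<open>0 * F1 r\<close> so that
    \<open>scal\<close> covers every component.\<close>
  have zs: "z00 = (\<lambda>b r. V0 b * ((c + \<i> * s) * F0 r) + V1 b * (c * F1 r))"
    "z11 = (\<lambda>b r. V0 b * (c * F0 r) + V1 b * ((c + \<i> * s) * F1 r))"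
    "z01 = (\<lambda>b r. V0 b * (0 * F0 r) + V1 b * (\<i> * s * F0 r))"
    "z10 = (\<lambda>b r. V0 b * (\<i> * s * F1 r) + V1 b * (0 * F1 r))"
    by (auto simp: fun_eq_iff z00_def z11_def z01_def z10_def)
  have mod1: "(c + \<i> * s) * (c - \<i> * s) = 1" using cs by (simp add: algebra_simps)
  have is2: "\<i> * s * (\<i> * s) = - (s * s)" by (simp add: algebra_simps)
  have I: "ip (flat z00) (flat z00) = complex_of_real (p0 + C^2 * p1)"
    "ip (flat z11) (flat z11) = complex_of_real (p1 + C^2 * p0)"
    "ip (flat z01) (flat z01) = complex_of_real (S^2 * p0)"
    "ip (flat z10) (flat z10) = complex_of_real (S^2 * p1)"
    "ip (flat z00) (flat z11) = (c + \<i> * s) * c * p0 + c * (c - \<i> * s) * p1"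
    "ip (flat z11) (flat z00) = c * (c - \<i> * s) * p0 + (c + \<i> * s) * c * p1"
    unfolding zs ipz scal pc
    using mod1 by (simp_all add: cnjs is2) (simp_all add: c_def s_def power2_eq_square)

  \<comment> \<open>Orthogonality of \<open>G0\<close> and \<open>G1\<close> removes the cross terms
    between the input levels of B and leaves the weights \<open>q0\<close> and
    \<open>q1\<close>.\<close>
  have gram: "(\<Sum>i<2 * dB. cnj (output_matrix (Ugate x) dA dB phi psi $$ (i, k)) *
      output_matrix (Ugate x) dA dB phi psi $$ (i, k')) = (\<Sum>i<4. cnj (z i k) * z i k')"
    if k: "k < 2 * dA" "k' < 2 * dA" for k k'
  proof -
    define e r e' r' where "e = k div dA" and "r = k mod dA" and "e' = k' div dA" and "r' = k' mod dA"
    have e: "e < 2" "e' < 2" using k by (auto simp: e_def e'_def less_mult_imp_div_less)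
    let ?A = "\<lambda>e r b. G0 b * z00 e r + G1 b * z01 e r"
    let ?B = "\<lambda>e r b. G0 b * z10 e r + G1 b * z11 e r"
    have "(\<Sum>i<2 * dB. cnj (output_matrix (Ugate x) dA dB phi psi $$ (i, k)) *
      output_matrix (Ugate x) dA dB phi psi $$ (i, k')) =
      (\<Sum>i<2 * dB. cnj (out_amp (Ugate x) dA dB phi psi e r (i div dB) (i mod dB))
         * out_amp (Ugate x) dA dB phi psi e' r' (i div dB) (i mod dB))"
      using k by (intro sum.cong) (auto simp: output_matrix_def e_def r_def e'_def r'_def)
    also have "\<dots> = (\<Sum>b<2. \<Sum>j<dB. cnj (out_amp (Ugate x) dA dB phi psi e r b j)
         * out_amp (Ugate x) dA dB phi psi e' r' b j)"
      by (rule sum_div_mod[OF d0(2), where h = "\<lambda>b j. cnj (out_amp (Ugate x) dA dB phi psi e r b j)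
         * out_amp (Ugate x) dA dB phi psi e' r' b j"])
    also have "\<dots> = (\<Sum>b<2. \<Sum>j<dB. (cnj \<omega> * \<omega>) * ((V0 b * ?A e' r' j + V1 b * ?B e' r' j)
         * cnj (V0 b * ?A e r j + V1 b * ?B e r j)))"
    proof (intro sum.cong refl)
      fix b j assume "b \<in> {..<2::nat}"
      then have b: "b < 2" by simp
      show "cnj (out_amp (Ugate x) dA dB phi psi e r b j) * out_amp (Ugate x) dA dB phi psi e' r' b j =
        (cnj \<omega> * \<omega>) * ((V0 b * ?A e' r' j + V1 b * ?B e' r' j) * cnj (V0 b * ?A e r j + V1 b * ?B e r j))"
        unfolding amp[OF e(1) b] amp[OF e(2) b] complex_cnj_mult by (simp only: mult_ac)
    qed
    also have "\<dots> = (\<Sum>j<dB. ?A e' r' j * cnj (?A e r j) + ?B e' r' j * cnj (?B e r j))"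
      unfolding \<omega> mult_1 by (subst sum.swap) (simp only: iso)
    also have "\<dots> = (\<Sum>j<dB. (z00 e' r' * cnj (z00 e r) + z10 e' r' * cnj (z10 e r)) * (G0 j * cnj (G0 j))
        + (z00 e' r' * cnj (z01 e r) + z10 e' r' * cnj (z11 e r)) * (G0 j * cnj (G1 j))
        + (z01 e' r' * cnj (z00 e r) + z11 e' r' * cnj (z10 e r)) * (G1 j * cnj (G0 j))
        + (z01 e' r' * cnj (z01 e r) + z11 e' r' * cnj (z11 e r)) * (G1 j * cnj (G1 j)))"
      by (intro sum.cong) (auto simp: algebra_simps)
    also have "\<dots> = (z00 e' r' * cnj (z00 e r) + z10 e' r' * cnj (z10 e r)) * q0
        + (z01 e' r' * cnj (z01 e r) + z11 e' r' * cnj (z11 e r)) * q1"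
      unfolding sum.distrib sum_distrib_left[symmetric] qc G01 G10 by simp
    also have "\<dots> = Z00 k' * cnj (Z00 k) + Z11 k' * cnj (Z11 k)
        + (z01 e' r' * cnj (z01 e r)) * q1 + (z10 e' r' * cnj (z10 e r)) * q0"
      unfolding Z00_def Z11_def flat_def e_def r_def e'_def r'_def sq[symmetric]
      by (simp add: algebra_simps)
    also have "Z00 k' * cnj (Z00 k) + Z11 k' * cnj (Z11 k) = w0 k' * cnj (w0 k) + w1 k' * cnj (w1 k)"
      using rotation_isometry[of "cnj t'" "- y'" "Z00 k'" "Z11 k'" "Z00 k" "Z11 k"] ty'
      by (simp add: w0_def w1_def mult.commute)
    also have "\<dots> + (z01 e' r' * cnj (z01 e r)) * q1 + (z10 e' r' * cnj (z10 e r)) * q0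
        = (\<Sum>i<4. cnj (z i k) * z i k')"
      unfolding sum_lessThan_4 z_def flat_def e_def r_def e'_def r'_def sq[symmetric]
      by (simp add: algebra_simps)
    finally show ?thesis .
  qed
  have X: "output_matrix (Ugate x) dA dB phi psi \<in> carrier_mat (2 * dB) (2 * dA)"
    by (simp add: output_matrix_def)
  have zn: "(\<Sum>k<2 * dA. (cmod (z 2 k))^2) = q1 * (S^2 * p0)" "(\<Sum>k<2 * dA. (cmod (z 3 k))^2) = q0 * (S^2 * p1)"
  proof -
    have "complex_of_real (\<Sum>k<2 * dA. (cmod (z 2 k))^2) = ip (\<lambda>k. sqrt q1 * flat z01 k) (\<lambda>k. sqrt q1 * flat z01 k)"
      unfolding sum_norm_sq_complex ip_def by (simp add: z_def)
    also have "\<dots> = complex_of_real (q1 * (S^2 * p0))"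
      unfolding ips I using nn by (simp flip: of_real_mult)
    finally show "(\<Sum>k<2 * dA. (cmod (z 2 k))^2) = q1 * (S^2 * p0)" by (simp only: of_real_eq_iff)
    have "complex_of_real (\<Sum>k<2 * dA. (cmod (z 3 k))^2) = ip (\<lambda>k. sqrt q0 * flat z10 k) (\<lambda>k. sqrt q0 * flat z10 k)"
      unfolding sum_norm_sq_complex ip_def by (simp add: z_def)
    also have "\<dots> = complex_of_real (q0 * (S^2 * p1))"
      unfolding ips I using nn by (simp flip: of_real_mult)
    finally show "(\<Sum>k<2 * dA. (cmod (z 3 k))^2) = q0 * (S^2 * p1)" by (simp only: of_real_eq_iff)
  qed
  have ent: "ent_out (Ugate x) dA dB phi psi
    \<le> eta l + eta m + eta (q1 * (S^2 * p0)) + eta (q0 * (S^2 * p1))"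
    using vn_entropy_le_of_equal_gram[OF X gram]
    unfolding ent_out_def reduced_BR_eq_gram[OF d0(1)] sum_lessThan_4 zn by (simp add: z_def l_def m_def)
  have lm: "complex_of_real l = ip w0 w0" "complex_of_real m = ip w1 w1"
    unfolding l_def m_def sum_norm_sq_complex ip_def by auto
  have Z: "ip Z00 Z00 = complex_of_real (q0 * (p0 + C^2 * p1))"
    "ip Z11 Z11 = complex_of_real (q1 * (p1 + C^2 * p0))"
    "ip Z00 Z11 = complex_of_real (sqrt q0 * sqrt q1) * ((c + \<i> * s) * c * p0 + c * (c - \<i> * s) * p1)"
    "ip Z11 Z00 = complex_of_real (sqrt q0 * sqrt q1) * (c * (c - \<i> * s) * p0 + (c + \<i> * s) * c * p1)"
    unfolding Z00_def Z11_def ips I by (simp_all add: sq)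
  have "complex_of_real (l + m) = ip Z00 Z00 + ip Z11 Z11"
    unfolding of_real_add lm
    using rotation_gram(1)[OF ty', where K = "{..<2 * dA}" and g = Z00 and h = Z11] by (simp only: ip_def w0_def w1_def)
  then have T: "l + m = q0 * (p0 + C^2 * p1) + q1 * (p1 + C^2 * p0)"
    unfolding Z of_real_add[symmetric] of_real_eq_iff .
  have "complex_of_real (l * m) = ip Z00 Z00 * ip Z11 Z11 - ip Z00 Z11 * ip Z11 Z00"
  proof -
    have "ip w0 w1 = 0" using orth' by (simp only: ip_def w0_def w1_def)
    then show ?thesis
      unfolding of_real_mult lm
      using rotation_gram(2)[OF ty', where K = "{..<2 * dA}" and g = Z00 and h = Z11] by (simp add: ip_def w0_def w1_def)
  qed
  \<comment> \<open>Up to the factor \<open>q0 * q1 * C^2\<close> this is the squared modulus of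
    \<open>(c + \<i> * s) * p0 + (c - \<i> * s) * p1\<close>; the difference
    \<open>C^2 - S^2\<close> is the real part of \<open>(c + \<i> * s)^2\<close>.\<close>
  also have "ip Z00 Z11 * ip Z11 Z00 = complex_of_real (q0 * q1 * (C^2 * (p0^2 + p1^2 + 2 * p0 * p1 * (C^2 - S^2))))"
  proof -
    have "complex_of_real (sqrt q0 * sqrt q1) * complex_of_real (sqrt q0 * sqrt q1) = complex_of_real (q0 * q1)"
      using nn by (simp flip: of_real_mult add: real_sqrt_mult[symmetric])
    moreover have "((c + \<i> * s) * c * p0 + c * (c - \<i> * s) * p1) * (c * (c - \<i> * s) * p0 + (c + \<i> * s) * c * p1)
      = c * c * ((c * c + s * s) * (p0^2 + p1^2) + 2 * p0 * p1 * (c * c - s * s))"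
      by (simp add: algebra_simps power2_eq_square)
    ultimately show ?thesis
      unfolding Z cs by (simp add: c_def s_def power2_eq_square mult_ac)
  qed
  finally have "complex_of_real (l * m) = complex_of_real (q0 * (p0 + C^2 * p1) * (q1 * (p1 + C^2 * p0))
    - q0 * q1 * (C^2 * (p0^2 + p1^2 + 2 * p0 * p1 * (C^2 - S^2))))"
    unfolding Z by simp
  then have D: "l * m = q0 * (p0 + C^2 * p1) * (q1 * (p1 + C^2 * p0))
    - q0 * q1 * (C^2 * (p0^2 + p1^2 + 2 * p0 * p1 * (C^2 - S^2)))"
    by (simp only: of_real_eq_iff)
  have a: "4 * a = S^2" "0 < a" "a \<le> 1/4"
    using s0 by (auto simp: a_def S_def abs_square_le_1)
  have lm0: "0 \<le> l" "0 \<le> m" by (auto simp: l_def m_def intro: sum_nonneg)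
  have "nent (4 * a * (p0 * (1 - q0))) + nent (4 * a * ((1 - p0) * q0)) + nent l + nent m
    \<le> max (nent (4 * a) + nent (1 - 4 * a)) (3 * nent a + nent (1 - 3 * a))"
  proof (rule product_weights_entropy_le)
    show "l + m = 1 - 4 * a * (p0 * (1 - q0) + (1 - p0) * q0)"
      unfolding T CS a p q by (simp add: algebra_simps)
    have "l * m = S^2 * (4 - 3 * S^2) * (p0 * (1 - q0) * ((1 - p0) * q0))"
      unfolding D CS p q by (simp add: algebra_simps power2_eq_square)
    also have "S^2 * (4 - 3 * S^2) = 16 * a * (1 - 3 * a)"
      unfolding a(1)[symmetric] by (simp add: algebra_simps)
    finally show "l * m = 16 * a * (1 - 3 * a) * (p0 * (1 - q0) * ((1 - p0) * q0))" .
  qed (use a nn p q lm0 in auto)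
  then have "(nent l + nent m + nent (q1 * (S^2 * p0)) + nent (q0 * (S^2 * p1))) / ln 2
    \<le> max (nent (4 * a) + nent (1 - 4 * a)) (3 * nent a + nent (1 - 3 * a)) / ln 2"
    unfolding a p q by (intro divide_right_mono) (simp_all add: mult_ac)
  moreover have "eta l + eta m + eta (q1 * (S^2 * p0)) + eta (q0 * (S^2 * p1)) =
    (nent l + nent m + nent (q1 * (S^2 * p0)) + nent (q0 * (S^2 * p1))) / ln 2"
    using nn lm0 by (simp add: eta_eq_nent add_divide_distrib)
  ultimately show ?thesis using ent by linarith
qed

section \<open>Exact entropies for the two optimal inputs\<close>

definition real_diag :: "nat \<Rightarrow> (nat \<Rightarrow> real) \<Rightarrow> complex mat" where
  "real_diag n d = mat n n (\<lambda>(i, j). if i = j then complex_of_real (d i) else 0)"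

lemma vn_entropy_real_diag: "vn_entropy (real_diag n d) = (\<Sum>i<n. eta (d i))"
proof -
  have D: "real_diag n d \<in> carrier_mat n n" by (simp add: real_diag_def)
  have "char_poly (real_diag n d) = (\<Prod>a\<leftarrow>diag_mat (real_diag n d). [:- a, 1:])"
    by (intro char_poly_upper_triangular[OF D]) (auto simp: upper_triangular_def real_diag_def)
  then have "vn_entropy (real_diag n d) = (\<Sum>a\<leftarrow>diag_mat (real_diag n d). eta (Re a))"
    by (simp only: vn_entropy_root_entropy root_entropy_prod_list)
  also have "\<dots> = (\<Sum>i<n. eta (Re (real_diag n d $$ (i, i))))"
    using D by (simp add: diag_mat_def interv_sum_list_conv_sum_set_nat atLeast0LessThan o_def)
  also have "\<dots> = (\<Sum>i<n. eta (d i))" by (simp add: real_diag_def)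
  finally show ?thesis .
qed

lemma less_4_cases: "i < 4 \<Longrightarrow> i = 0 \<or> i = 1 \<or> i = 2 \<or> i = (3::nat)"
  by auto

lemma i_mult_square: "\<i> * z * (\<i> * z) = - (z * z)"
  by (simp add: algebra_simps)

lemma reduced_BR_Ugate_index:
  assumes "i < 4" "j < 4"
  shows "reduced_BR (Ugate x) 2 2 phi psi $$ (i, j) = (\<Sum>a<2. \<Sum>r<2.
    (complex_of_real (cos (2 * x)) * phi $ (a * 2 + r) * psi $ (i div 2 * 2 + i mod 2)
     + \<i> * complex_of_real (sin (2 * x)) * phi $ (i div 2 * 2 + r) * psi $ (a * 2 + i mod 2)) *
    cnj (complex_of_real (cos (2 * x)) * phi $ (a * 2 + r) * psi $ (j div 2 * 2 + j mod 2)
     + \<i> * complex_of_real (sin (2 * x)) * phi $ (j div 2 * 2 + r) * psi $ (a * 2 + j mod 2)))"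
proof -
  have phase: "e * A * cnj (e * B) = e * cnj e * (A * cnj B)" for e A B :: complex by simp
  have "reduced_BR (Ugate x) 2 2 phi psi $$ (i, j) = (\<Sum>a<2. \<Sum>r<2.
      out_amp (Ugate x) 2 2 phi psi a r (i div 2) (i mod 2)
        * cnj (out_amp (Ugate x) 2 2 phi psi a r (j div 2) (j mod 2)))"
    using assms by (simp add: reduced_BR_def)
  also have "\<dots> = (\<Sum>a<2. \<Sum>r<2.
    (complex_of_real (cos (2 * x)) * phi $ (a * 2 + r) * psi $ (i div 2 * 2 + i mod 2)
     + \<i> * complex_of_real (sin (2 * x)) * phi $ (i div 2 * 2 + r) * psi $ (a * 2 + i mod 2)) *
    cnj (complex_of_real (cos (2 * x)) * phi $ (a * 2 + r) * psi $ (j div 2 * 2 + j mod 2)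
     + \<i> * complex_of_real (sin (2 * x)) * phi $ (j div 2 * 2 + r) * psi $ (a * 2 + j mod 2)))"
  proof (intro sum.cong refl)
    fix a r assume "a \<in> {..<2::nat}"
    then have "a < 2" "i div 2 < 2" "j div 2 < 2" using assms by auto
    then show "out_amp (Ugate x) 2 2 phi psi a r (i div 2) (i mod 2)
        * cnj (out_amp (Ugate x) 2 2 phi psi a r (j div 2) (j mod 2)) =
    (complex_of_real (cos (2 * x)) * phi $ (a * 2 + r) * psi $ (i div 2 * 2 + i mod 2)
     + \<i> * complex_of_real (sin (2 * x)) * phi $ (i div 2 * 2 + r) * psi $ (a * 2 + i mod 2)) *
    cnj (complex_of_real (cos (2 * x)) * phi $ (a * 2 + r) * psi $ (j div 2 * 2 + j mod 2)
     + \<i> * complex_of_real (sin (2 * x)) * phi $ (j div 2 * 2 + r) * psi $ (a * 2 + j mod 2))"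
      by (simp only: out_amp_Ugate phase phase_cnj mult_1)
  qed
  finally show ?thesis .
qed

lemma ent_out_ket00_ket11:
  "ent_out (Ugate x) 2 2 ket00 ket11 = eta ((cos (2 * x))^2) + eta ((sin (2 * x))^2)"
proof -
  \<comment> \<open>The gate sends |01> to a superposition of |01> and |10>, while the ancillas stay
    at 0 and 1. On B with its ancilla this leaves |11> (index 3) and |01> (index 1).\<close>
  let ?d = "\<lambda>i::nat. if i = 3 then (cos (2 * x))^2 else if i = 1 then (sin (2 * x))^2 else 0"
  have "reduced_BR (Ugate x) 2 2 ket00 ket11 = real_diag 4 ?d"
  proof (rule eq_matI)
    fix i j assume "i < dim_row (real_diag 4 ?d)" "j < dim_col (real_diag 4 ?d)"
    then have ij: "i < 4" "j < 4" by (auto simp: real_diag_def)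
    from less_4_cases[OF ij(1)] less_4_cases[OF ij(2)]
    show "reduced_BR (Ugate x) 2 2 ket00 ket11 $$ (i, j) = real_diag 4 ?d $$ (i, j)"
      unfolding reduced_BR_Ugate_index[OF ij] sum_lessThan_2 ket00_def ket11_def
      by (elim disjE) (simp_all add: real_diag_def power2_eq_square i_mult_square)
  qed (auto simp: reduced_BR_def real_diag_def)
  then show ?thesis
    by (simp add: ent_out_def vn_entropy_real_diag sum_lessThan_4) (simp add: eta_def)
qed

lemma ent_out_bell_bell:
  "ent_out (Ugate x) 2 2 bell bell = eta (1 - 3 * ((sin (2 * x))^2 / 4)) + 3 * eta ((sin (2 * x))^2 / 4)"
proof -
  define S where "S = (sin (2 * x))^2 / 4"
  have C: "(cos (2 * x))^2 = 1 - 4 * S" by (simp add: S_def cos_squared_eq)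
  define A where "A = reduced_BR (Ugate x) 2 2 bell bell"
  \<comment> \<open>The reduced state is diagonal apart from the block on indices 0 and 3, whose
    eigenvectors are the sum and difference of the two basis vectors. \<open>P\<close> holds them
    unnormalized, and \<open>Q\<close> inverts it.\<close>
  define P where "P = mat 4 4 (\<lambda>(i, j). if i = 3 \<and> j = 3 then - 1
    else if i = j \<or> (i = 0 \<and> j = 3) \<or> (i = 3 \<and> j = 0) then (1::complex) else 0)"
  define Q where "Q = mat 4 4 (\<lambda>(i, j). if i = 3 \<and> j = 3 then - 1/2
    else if (i = 0 \<or> i = 3) \<and> (j = 0 \<or> j = 3) then 1/2 else if i = j then (1::complex) else 0)"
  define D where "D = real_diag 4 (\<lambda>i. if i = 0 then 1 - 3 * S else S)"
  have car: "P \<in> carrier_mat 4 4" "Q \<in> carrier_mat 4 4" "D \<in> carrier_mat 4 4"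
    by (auto simp: P_def Q_def D_def real_diag_def)
  have DQ: "D * Q \<in> carrier_mat 4 4" using car by auto
  have QP: "Q * P = 1\<^sub>m 4"
  proof (rule eq_matI)
    fix i j assume "i < dim_row (1\<^sub>m 4 :: complex mat)" "j < dim_col (1\<^sub>m 4 :: complex mat)"
    then have ij: "i < 4" "j < 4" by auto
    from less_4_cases[OF ij(1)] less_4_cases[OF ij(2)]
    show "(Q * P) $$ (i, j) = 1\<^sub>m 4 $$ (i, j)"
      unfolding mat_mult_index[OF car(2) car(1) ij] sum_lessThan_4
      by (elim disjE) (simp_all add: P_def Q_def)
  qed (use car in auto)
  have "A = P * (D * Q)"
  proof (rule eq_matI)
    fix i j assume "i < dim_row (P * (D * Q))" "j < dim_col (P * (D * Q))"
    then have ij: "i < 4" "j < 4" using car by auto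
    have DQ_ij: "(D * Q) $$ (l, j) = (if l = 0 then 1 - 3 * complex_of_real S else complex_of_real S) * Q $$ (l, j)"
      if "l < 4" for l
      unfolding mat_mult_index[OF car(3) car(2) that ij(2)] sum_lessThan_4
      using less_4_cases[OF that] by (elim disjE) (simp_all add: D_def real_diag_def)
    have "(P * (D * Q)) $$ (i, j) = P $$ (i, 0) * ((1 - 3 * complex_of_real S) * Q $$ (0, j))
      + P $$ (i, 1) * (complex_of_real S * Q $$ (1, j)) + P $$ (i, 2) * (complex_of_real S * Q $$ (2, j))
      + P $$ (i, 3) * (complex_of_real S * Q $$ (3, j))"
      unfolding mat_mult_index[OF car(1) DQ ij] sum_lessThan_4 by (simp add: DQ_ij del: One_nat_def)
    also have "\<dots> = (if (i = 0 \<or> i = 3) \<and> (j = 0 \<or> j = 3) then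
      (if i = j then (1 - 2 * complex_of_real S) / 2 else (1 - 4 * complex_of_real S) / 2)
      else if i = j then complex_of_real S else 0)"
      using less_4_cases[OF ij(1)] less_4_cases[OF ij(2)]
      by (elim disjE) (simp_all add: P_def Q_def field_simps)
    finally have "(P * (D * Q)) $$ (i, j) = \<dots>" .
    moreover have "A $$ (i, j) = (if (i = 0 \<or> i = 3) \<and> (j = 0 \<or> j = 3) then
      (if i = j then (1 - 2 * complex_of_real S) / 2 else (1 - 4 * complex_of_real S) / 2)
      else if i = j then complex_of_real S else 0)"
    proof -
      have c2: "complex_of_real (cos (2 * x)) * complex_of_real (cos (2 * x)) = 1 - 4 * complex_of_real S"
        using arg_cong[OF C, of complex_of_real] by (simp add: power2_eq_square)
      have s2: "complex_of_real (sin (2 * x)) * complex_of_real (sin (2 * x)) = 4 * complex_of_real S"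
        by (simp add: S_def power2_eq_square)
      have h2: "complex_of_real (1 / sqrt 2) * complex_of_real (1 / sqrt 2) = 1/2"
        by (simp flip: of_real_mult add: real_sqrt_mult[symmetric])
      define h c s where "h = complex_of_real (1 / sqrt 2)" and "c = complex_of_real (cos (2 * x))"
        and "s = complex_of_real (sin (2 * x))"
      have bell: "bell $ 0 = h" "bell $ 1 = 0" "bell $ 2 = 0" "bell $ 3 = h"
        by (simp_all add: bell_def h_def)
      have cnjs: "cnj h = h" "cnj c = c" "cnj s = s" by (simp_all add: h_def c_def s_def)
      have hh: "h * h = 1/2" and cc: "c * c = 1 - 4 * complex_of_real S" and ss: "s * s = 4 * complex_of_real S"
        using h2 c2 s2 by (simp_all only: h_def c_def s_def)
      have mod2: "(c / 2 + \<i> * s / 2) * (c - \<i> * s) = 1/2"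
      proof -
        have "(c / 2 + \<i> * s / 2) * (c - \<i> * s) = (c * c + s * s) / 2" by (simp add: field_simps)
        then show ?thesis by (simp add: cc ss)
      qed
      have re: "(c / 2 + \<i> * s / 2) * c + c * (c - \<i> * s) / 2 = 1 - 4 * complex_of_real S"
        "c * (c - \<i> * s) / 2 + (c / 2 + \<i> * s / 2) * c = 1 - 4 * complex_of_real S"
        unfolding cc[symmetric] by (simp_all add: field_simps)
      have is2: "\<i> * (s * (\<i> * s)) = - (4 * complex_of_real S)"
        unfolding ss[symmetric] by (simp add: algebra_simps)
      show ?thesis
        unfolding A_def reduced_BR_Ugate_index[OF ij] sum_lessThan_2 c_def[symmetric] s_def[symmetric]
        using less_4_cases[OF ij(1)] less_4_cases[OF ij(2)]
        by (elim disjE) (simp_all add: bell bell[simplified] mult.assoc hh cnjs mod2 re is2 cc,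
          simp_all add: field_simps)
    qed
    ultimately show "A $$ (i, j) = (P * (D * Q)) $$ (i, j)" by simp
  qed (use car in \<open>auto simp: A_def reduced_BR_def\<close>)
  then have "vn_entropy A = vn_entropy ((D * Q) * P)" using vn_entropy_mult_commute[OF car(1) DQ] by simp
  also have "(D * Q) * P = D" using car QP by (simp add: assoc_mult_mat[of _ 4 4 _ 4 _ 4])
  finally show ?thesis
    by (simp add: ent_out_def A_def D_def vn_entropy_real_diag sum_lessThan_4 S_def)
qed

section \<open>The maximum and the crossing point\<close>

lemma entangling_power_eqI:
  assumes "1 \<le> dA" "1 \<le> dB" "unit_state (2 * dA) phi" "unit_state (2 * dB) psi"
    and "ent_out U dA dB phi psi = v"
    and "\<And>dA dB phi psi. 1 \<le> dA \<Longrightarrow> 1 \<le> dB \<Longrightarrow> unit_state (2 * dA) phi \<Longrightarrow> unit_state (2 * dB) psi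
      \<Longrightarrow> ent_out U dA dB phi psi \<le> v"
  shows "entangling_power U = v"
  unfolding entangling_power_def using assms by (intro cSup_eq_maximum) auto

theorem theorem2:
  fixes x x0 :: real
  assumes x0_approx: "0.1 < x0" "x0 < 0.11"
    and x0_root: "shannon [(cos (2 * x0))^2, (sin (2 * x0))^2] =
       shannon [(cos x0)^6 + (sin x0)^6, (cos x0)^2 * (sin x0)^2,
                (cos x0)^2 * (sin x0)^2, (cos x0)^2 * (sin x0)^2]"
    and x_range: "0 < x" "x \<le> pi / 4"
  shows "(x \<le> x0 \<longrightarrow>
            entangling_power (Ugate x) = shannon [(cos (2 * x))^2, (sin (2 * x))^2] \<and>
            ent_out (Ugate x) 2 2 ket00 ket11 = shannon [(cos (2 * x))^2, (sin (2 * x))^2])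
       \<and> (x0 \<le> x \<longrightarrow>
            entangling_power (Ugate x) =
              shannon [(cos x)^6 + (sin x)^6, (cos x)^2 * (sin x)^2,
                       (cos x)^2 * (sin x)^2, (cos x)^2 * (sin x)^2] \<and>
            ent_out (Ugate x) 2 2 bell bell =
              shannon [(cos x)^6 + (sin x)^6, (cos x)^2 * (sin x)^2,
                       (cos x)^2 * (sin x)^2, (cos x)^2 * (sin x)^2])"
proof -
  \<comment> \<open>In terms of \<open>a z\<close>, which also equals
    \<open>(cos z)^2 * (sin z)^2\<close>, both entropies are functions of one variable.\<close>
  define a where "a z = (sin (2 * z))^2 / 4" for z :: real
  define H1 where "H1 b = nent (4 * b) + nent (1 - 4 * b)" for b
  define H2 where "H2 b = 3 * nent b + nent (1 - 3 * b)" for b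
  have a_range: "0 \<le> a z" "a z \<le> 1/4" for z
    by (simp_all add: a_def abs_square_le_1)
  have prod: "(cos z)^2 * (sin z)^2 = a z" for z
    by (simp add: a_def sin_double power2_eq_square)
  have six: "(cos z)^6 + (sin z)^6 = 1 - 3 * a z" for z
  proof -
    have "p^6 + q^6 = (p^2 + q^2)^3 - 3 * (p^2 * q^2) * (p^2 + q^2)" for p q :: real
      by (simp add: eval_nat_numeral algebra_simps)
    from this[of "cos z" "sin z"] show ?thesis by (simp add: prod)
  qed
  have cos2: "(cos (2 * z))^2 = 1 - 4 * a z" and sin2: "(sin (2 * z))^2 = 4 * a z" for z
    by (simp_all add: a_def cos_squared_eq)
  have sh1: "shannon [(cos (2 * z))^2, (sin (2 * z))^2] = H1 (a z) / ln 2" for z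
    unfolding cos2 sin2 using a_range[of z]
    by (simp add: shannon_def H1_def eta_eq_nent add_divide_distrib)
  have sh2: "shannon [(cos z)^6 + (sin z)^6, (cos z)^2 * (sin z)^2,
      (cos z)^2 * (sin z)^2, (cos z)^2 * (sin z)^2] = H2 (a z) / ln 2" for z
    unfolding prod six using a_range[of z]
    by (simp add: shannon_def H2_def eta_eq_nent add_divide_distrib)
  have e1: "ent_out (Ugate x) 2 2 ket00 ket11 = H1 (a x) / ln 2"
    unfolding ent_out_ket00_ket11 sh1[symmetric] by (simp add: shannon_def)
  have e2: "ent_out (Ugate x) 2 2 bell bell = H2 (a x) / ln 2"
    unfolding ent_out_bell_bell a_def[symmetric] using a_range[of x]
    by (simp add: H2_def eta_eq_nent add_divide_distrib)
  have u1: "unit_state (2 * 2) ket00" "unit_state (2 * 2) ket11"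
    by (auto simp: unit_state_def ket00_def ket11_def sum_lessThan_4)
  have u2: "unit_state (2 * 2) bell"
    by (auto simp: unit_state_def bell_def sum_lessThan_4 norm_divide power_divide)

  have s0: "0 < sin (2 * x)" using x_range by (intro sin_gt_zero) auto
  then have ax: "0 < a x" by (simp add: a_def)
  have up: "ent_out (Ugate x) dA dB phi psi \<le> max (H1 (a x)) (H2 (a x)) / ln 2"
    if "1 \<le> dA" "1 \<le> dB" "unit_state (2 * dA) phi" "unit_state (2 * dB) psi" for dA dB phi psi
    unfolding H1_def H2_def a_def using s0 by (intro ent_out_Ugate_le that) simp

  have x0: "0 < x0" "x0 < pi / 4" using x0_approx pi_ge_two by auto
  have "0 < sin (2 * x0)" using x0 by (intro sin_gt_zero) auto
  then have ax0: "0 < a x0" by (simp add: a_def)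
  have "sin (2 * x0) < sin (pi / 2)" using x0 by (intro sin_monotone_2pi) auto
  then have "(sin (2 * x0))^2 < 1^2" using \<open>0 < sin (2 * x0)\<close> by (intro power_strict_mono) auto
  then have ax0': "a x0 < 1/4" by (simp add: a_def)
  \<comment> \<open>The gap vanishes at the root. Since its ratio to \<open>a\<close> is monotone
    and \<open>a\<close> increases up to \<open>pi / 4\<close>, this settles its sign on either
    side.\<close>
  have W0: "H2 (a x0) - H1 (a x0) = 0"
    using x0_root unfolding sh1 sh2 by simp
  have a_mono: "a v \<le> a w" if "0 \<le> v" "v \<le> w" "w \<le> pi / 4" for v w
  proof -
    have "sin (2 * v) \<le> sin (2 * w)" using that by (intro sin_monotone_2pi_le) auto
    moreover have "0 \<le> sin (2 * v)" using that by (intro sin_ge_zero) auto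
    ultimately show ?thesis by (simp add: a_def power_mono)
  qed

  have "H2 (a x) \<le> H1 (a x)" if "x \<le> x0"
  proof -
    have "a x \<le> a x0" using that x0 x_range by (intro a_mono) auto
    from entropy_gap_ratio_mono[OF ax this ax0', folded H1_def H2_def] W0
    have "(H2 (a x) - H1 (a x)) / a x \<le> 0" by simp
    then show ?thesis using ax by (simp add: divide_le_0_iff)
  qed
  then have part1: "entangling_power (Ugate x) = H1 (a x) / ln 2" if "x \<le> x0"
    using that u1 e1 up by (intro entangling_power_eqI[of 2 2]) (auto simp: max_def)

  have "H1 (a x) \<le> H2 (a x)" if "x0 \<le> x"
  \<comment> \<open>The ratio argument stops short of \<open>a x = 1/4\<close>; there
    \<open>H1\<close> is 0 and \<open>H2\<close> is \<open>ln 4\<close>.\<close>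
  proof (cases "a x < 1/4")
    case True
    have "a x0 \<le> a x" using that x0 x_range by (intro a_mono) auto
    from entropy_gap_ratio_mono[OF ax0 this True, folded H1_def H2_def] W0
    have "0 \<le> (H2 (a x) - H1 (a x)) / a x" by simp
    then show ?thesis using ax by (simp add: zero_le_divide_iff)
  next
    case False
    then have ax4: "a x = 1/4" using a_range(2)[of x] by simp
    show ?thesis unfolding ax4 by (simp add: H1_def H2_def nent_def ln_div)
  qed
  then have part2: "entangling_power (Ugate x) = H2 (a x) / ln 2" if "x0 \<le> x"
    using that u2 e2 up by (intro entangling_power_eqI[of 2 2]) (auto simp: max_def)

  show ?thesis unfolding sh1 sh2 using part1 part2 e1 e2 by simp
qed

end
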